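(* Let $n,k\ge 1$, let $S=S(X,B_1,\ldots,B_k)$ be an interlaced symmetric word, let $B_1,\ldots,B_k$ be real $n\times n$ positive definite matrices and let $P$ be a real $n\times n$ positive semidefinite matrix. Let $f(X)=S(X,B_1,\ldots,B_k)$. Then the set of real positive semidefinite $n\times n$ matrices $X$ with $f(X)=P$ is bounded. In addition, if $P$ is invertible, then there is a bounded open subset $U$ (open in the space of real symmetric $n\times n$ matrices) of the set of real positive definite $n\times n$ matrices, containing every real positive semidefinite $X$ with $f(X)=P$, such that $$\deg(f,U,P)=1.$$
   Context: Real positive definite (semidefinite) matrices are real symmetric matrices with all eigenvalues positive (nonnegative). Words are elements of the free monoid on the letters $X,B_1,\ldots,B_k$. A word is symmetric if it equals its reversal (palindrome). A word is interlaced if it has the form $W=B_{i_1}^{q_1}\prod_{j=1}^{m}X^{p_j}B_{i_{j+1}}^{q_{j+1}}$ with $m\ge 1$, integers $p_j>0$, $q_j\ge 0$ and $i_j\in\{1,\ldots,k\}$ (the zeroth power of a letter is the empty word). $S(X,B_1,\ldots,B_k)$ denotes the matrix product obtained by substituting matrices for letters. The space $\mathrm{Sym}_n$ of real symmetric $n\times n$ matrices is identified with $\mathbb{R}^{n(n+1)/2}$ by listing the lower triangular entries $(a_{11},\ldots,a_{n1},a_{22},\ldots,a_{n2},\ldots,a_{nn})$; since $S$ is symmetric, $f$ maps $\mathrm{Sym}_n$ to itself. $\deg(f,U,P)$ is the Brouwer degree, under this identification, of the continuous map $f:\overline{U}\to \mathrm{Sym}_n$ at $P$ with respect to the bounded open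 set $U$; it is defined when $P\notin f(\partial U)$ (which is part of the assertion). *)

theory Defs
  imports "HOL-Analysis.Analysis" "HOL-Homology.Homology"
begin

section \<open>Words\<close>

text \<open>Words are lists of letters. Which letters \<open>LetB i\<close> are admitted (\<open>1 \<le> i \<le> k\<close>)
  is part of \<open>interlaced k\<close>.\<close>

datatype letter = LetX | LetB nat

type_synonym word = "letter list"

definition symmetric_word :: "word \<Rightarrow> bool" where
  "symmetric_word w \<longleftrightarrow> rev w = w"

text \<open>\<open>W = B\<^bsub>i 1\<^esub>\<^bsup>q 1\<^esup> \<Prod>\<^bsub>j=1..m\<^esub> X\<^bsup>p j\<^esup> B\<^bsub>i (j+1)\<^esub>\<^bsup>q (j+1)\<^esup>\<close>.\<close>

definition interlaced :: "nat \<Rightarrow> word \<Rightarrow> bool" where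
  "interlaced k w \<longleftrightarrow>
     (\<exists>(m::nat) (i::nat \<Rightarrow> nat) (p::nat \<Rightarrow> nat) (q::nat \<Rightarrow> nat).
        m \<ge> 1 \<and> (\<forall>j\<in>{1..m}. p j > 0) \<and> (\<forall>j\<in>{1..m+1}. i j \<in> {1..k}) \<and>
        w = replicate (q 1) (LetB (i 1)) @
            concat (map (\<lambda>j. replicate (p j) LetX @ replicate (q (j+1)) (LetB (i (j+1)))) [1..<m+1]))"

fun letter_subst :: "letter \<Rightarrow> real^'n^'n \<Rightarrow> (nat \<Rightarrow> real^'n^'n) \<Rightarrow> real^'n^'n" where
  "letter_subst LetX X B = X"
| "letter_subst (LetB i) X B = B i"

definition word_subst :: "word \<Rightarrow> real^'n^'n \<Rightarrow> (nat \<Rightarrow> real^'n^'n) \<Rightarrow> real^'n^'n" where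
  "word_subst w X B = foldr (\<lambda>l M. letter_subst l X B ** M) w (mat 1)"

section \<open>Positive definite and semidefinite matrices\<close>

definition Sym :: "(real^'n^'n) set" where
  "Sym = {A. transpose A = A}"

text \<open>Real eigenvalues suffice, since the matrices considered below are real symmetric.\<close>

definition is_eigenvalue :: "real^'n^'n \<Rightarrow> real \<Rightarrow> bool" where
  "is_eigenvalue A c \<longleftrightarrow> (\<exists>v. v \<noteq> 0 \<and> A *v v = c *\<^sub>R v)"

definition pos_def :: "real^'n^'n \<Rightarrow> bool" where
  "pos_def A \<longleftrightarrow> A \<in> Sym \<and> (\<forall>c. is_eigenvalue A c \<longrightarrow> c > 0)"

definition pos_semidef :: "real^'n^'n \<Rightarrow> bool" where
  "pos_semidef A \<longleftrightarrow> A \<in> Sym \<and> (\<forall>c. is_eigenvalue A c \<longrightarrow> c \<ge> 0)"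

section \<open>Brouwer degree with respect to a bounded open set\<close>

text \<open>The library provides the (homological) degree \<open>Brouwer_degree2 N\<close> of self-maps of
  \<open>nsphere N\<close>; it is used to define \<open>deg(g, V, y)\<close> for \<open>V\<close> bounded and open in
  \<open>Euclidean_space N\<close> (\<open>N \<ge> 1\<close>), \<open>g\<close> continuous on the closure of \<open>V\<close>, and \<open>y\<close> outside
  \<open>g ` \<partial>V\<close>. Identify the sphere with the one-point compactification of \<open>\<real>\<^sup>N\<close> by
  stereographic projection, the north pole being the point at infinity. With
  \<open>r = dist(y, g ` \<partial>V) > 0\<close>, let the points of \<open>V\<close> that \<open>g\<close> sends into the open \<open>r\<close>-ball
  around \<open>y\<close> be mapped by \<open>g\<close> followed by the radial homeomorphism \<open>y + v \<mapsto> v / (r - |v|)\<close> of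
  that ball onto \<open>\<real>\<^sup>N\<close>, and let all other points go to infinity. This is a continuous
  self-map of the sphere, and \<open>deg(g, V, y)\<close> is its degree: it is the integer by which \<open>g\<close> acts
  on the fundamental class, from \<open>H\<^sub>N(V, V - g\<^sup>-\<^sup>1(y))\<close> to \<open>H\<^sub>N(\<real>\<^sup>N, \<real>\<^sup>N - y)\<close>. In the smooth
  case, at a regular value, it is the sum of the signs of the Jacobian determinants over the
  preimages of \<open>y\<close> in \<open>V\<close>. Source and target use the same chart, so no choice of orientation
  enters and the identity has degree 1 at the points of \<open>V\<close>.\<close>

definition enorm :: "nat \<Rightarrow> (nat \<Rightarrow> real) \<Rightarrow> real" where
  "enorm N x = sqrt (\<Sum>i<N. (x i)\<^sup>2)"

definition north_pole :: "nat \<Rightarrow> nat \<Rightarrow> real" where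
  "north_pole N = (\<lambda>i. if i = N then 1 else 0)"

definition stereo :: "nat \<Rightarrow> (nat \<Rightarrow> real) \<Rightarrow> nat \<Rightarrow> real" where
  "stereo N s = (\<lambda>i. if i < N then s i / (1 - s N) else 0)"

definition inv_stereo :: "nat \<Rightarrow> (nat \<Rightarrow> real) \<Rightarrow> nat \<Rightarrow> real" where
  "inv_stereo N x =
     (\<lambda>i. if i < N then 2 * x i / ((enorm N x)\<^sup>2 + 1)
          else if i = N then ((enorm N x)\<^sup>2 - 1) / ((enorm N x)\<^sup>2 + 1)
          else 0)"

definition boundary_dist ::
  "nat \<Rightarrow> ((nat \<Rightarrow> real) \<Rightarrow> nat \<Rightarrow> real) \<Rightarrow> (nat \<Rightarrow> real) set \<Rightarrow> (nat \<Rightarrow> real) \<Rightarrow> real" where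
  "boundary_dist N g V y = (INF z \<in> Euclidean_space N frontier_of V. enorm N (\<lambda>i. g z i - y i))"

definition sphere_map ::
  "nat \<Rightarrow> ((nat \<Rightarrow> real) \<Rightarrow> nat \<Rightarrow> real) \<Rightarrow> (nat \<Rightarrow> real) set \<Rightarrow> (nat \<Rightarrow> real)
     \<Rightarrow> (nat \<Rightarrow> real) \<Rightarrow> nat \<Rightarrow> real" where
  "sphere_map N g V y s =
     (let r = boundary_dist N g V y; v = (\<lambda>i. g (stereo N s) i - y i) in
      if s \<noteq> north_pole N \<and> stereo N s \<in> V \<and> enorm N v < r
      then inv_stereo N (\<lambda>i. v i / (r - enorm N v))
      else north_pole N)"

definition brouwer_deg ::
  "nat \<Rightarrow> ((nat \<Rightarrow> real) \<Rightarrow> nat \<Rightarrow> real) \<Rightarrow> (nat \<Rightarrow> real) set \<Rightarrow> (nat \<Rightarrow> real) \<Rightarrow> int" where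
  "brouwer_deg N g V y = Brouwer_degree2 N (sphere_map N g V y)"

section \<open>Brouwer degree on symmetric matrices\<close>

text \<open>Positions of the lower triangular entries, column by column; the row and column
  indices are the elements of the finite linearly ordered type \<open>'n\<close>.\<close>

definition lower_tri :: "('n::{finite,linorder} \<times> 'n) list" where
  "lower_tri =
     concat (map (\<lambda>j. map (\<lambda>i. (i, j)) (filter (\<lambda>i. j \<le> i) (sorted_list_of_set UNIV)))
                 (sorted_list_of_set UNIV))"

definition vech :: "real^('n::{finite,linorder})^('n::{finite,linorder}) \<Rightarrow> nat \<Rightarrow> real" where
  "vech A = (\<lambda>l. if l < length (lower_tri :: ('n \<times> 'n) list)
                 then (case lower_tri ! l of (i, j) \<Rightarrow> A $ i $ j) else 0)"

definition unvech :: "(nat \<Rightarrow> real) \<Rightarrow> real^('n::{finite,linorder})^('n::{finite,linorder})" where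
  "unvech = inv_into Sym vech"

definition sym_deg ::
  "(real^('n::{finite,linorder})^('n::{finite,linorder}) \<Rightarrow> real^('n::{finite,linorder})^('n::{finite,linorder})) \<Rightarrow> (real^('n::{finite,linorder})^('n::{finite,linorder})) set \<Rightarrow> real^('n::{finite,linorder})^('n::{finite,linorder}) \<Rightarrow> int" where
  "sym_deg f U P =
     brouwer_deg (CARD('n) * (CARD('n) + 1) div 2) (vech \<circ> f \<circ> unvech) (vech ` U) (vech P)"

end

(*
  For an interlaced word S and positive semidefinite Y, every factor Y B^q maps the range of Y
  injectively into itself when B is positive definite. Hence S(Y,B) = 0 only if Y = 0, and by
  homogeneity and compactness |S(X,B)| >= c |X|^d with a constant c > 0 that is uniform along
  paths of positive definite B. So the solutions of S(X,B) = P stay in a bounded set while each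
  B_i moves linearly to the identity, where S(X,B) becomes X^d; then (1-s) X^d + s X moves on to
  the identity map with solutions bounded in the same way. When P is invertible, no solution is
  singular, so no solution meets the boundary of U = {X positive definite, |X| < R} for large R.
  Homotopy invariance therefore gives deg(f,U,P) = deg(id,U,P) = 1.
*)
theory Submission
  imports Defs
begin

section \<open>The degree as a degree of collapse maps\<close>

text \<open>The detour through \<open>B i\<close> = identity has a reason. On a direct path (1-s)
  S(X,B) + s X, a singular X may give an invertible value: for n = 2, S = B X B and X = v v^T with v
  not an eigenvector of B, the kernels of B X B and X meet only in 0, so every value with 0 < s < 1
  is invertible. Invertibility of P would then no longer keep solutions away from singular X. Once
  the word has become X^d, a kernel vector of X is a kernel vector of every mixture with X. The
  price is that (1-s) X^d + s X is not homogeneous in X; rescaling X changes s as well, which a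
  bound uniform in s absorbs. On the topological side, the collapse radius in
  \<open>sphere_map\<close> is the distance from the target to the image of the frontier, so it
  changes along a homotopy of the map. Working with collapse maps of arbitrary admissible radius
  separates the two effects. This distance is meaningful only for a nonempty frontier; for the set
  used here the zero matrix is a frontier point.\<close>

definition esp :: "nat \<Rightarrow> (nat \<Rightarrow> real) set" where
  "esp N = {x. \<forall>i\<ge>N. x i = 0}"

definition sph :: "nat \<Rightarrow> (nat \<Rightarrow> real) set" where
  "sph N = {x. (\<Sum>i\<le>N. (x i)\<^sup>2) = 1 \<and> (\<forall>i>N. x i = 0)}"

lemma Euclidean_space_eq: "Euclidean_space N = top_of_set (esp N)"
  by (simp add: Euclidean_space_def esp_def euclidean_product_topology)

lemma nsphere_eq: "nsphere N = top_of_set (sph N)"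
  by (simp add: nsphere sph_def euclidean_product_topology)

lemma closed_esp: "closed (esp N)"
  using closedin_Euclidean_imp_closed[OF closedin_topspace[of "Euclidean_space N"]]
  by (simp add: esp_def topspace_Euclidean_space)

lemma closed_sph: "closed (sph N)"
proof -
  have "sph N = {x. (\<Sum>i\<le>N. (x i)\<^sup>2) = 1} \<inter> esp (Suc N)"
    by (auto simp: sph_def esp_def Suc_le_eq)
  moreover have "closed {x::nat \<Rightarrow> real. (\<Sum>i\<le>N. (x i)\<^sup>2) = 1}"
    by (intro closed_Collect_eq continuous_intros continuous_on_product_coordinates)
  ultimately show ?thesis using closed_esp by auto
qed

lemma enorm_L2_set: "enorm N x = L2_set x {..<N}"
  by (simp add: enorm_def L2_set_def)

lemma enorm_nonneg: "0 \<le> enorm N x"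
  by (simp add: enorm_def sum_nonneg)

lemma enorm_sq: "(enorm N x)\<^sup>2 = (\<Sum>i<N. (x i)\<^sup>2)"
  by (simp add: enorm_def sum_nonneg)

lemma enorm_eq_0: "enorm N x = 0 \<longleftrightarrow> (\<forall>i<N. x i = 0)"
  by (auto simp: enorm_L2_set L2_set_eq_0_iff)

lemma enorm_scale: "enorm N (\<lambda>i. c * x i) = \<bar>c\<bar> * enorm N x"
  by (simp add: enorm_def power_mult_distrib real_sqrt_mult flip: sum_distrib_left)

lemma continuous_on_enorm [continuous_intros]:
  assumes "\<And>i. i < N \<Longrightarrow> continuous_on S (\<lambda>z. f z i)"
  shows "continuous_on S (\<lambda>z. enorm N (f z))"
  unfolding enorm_def by (intro continuous_intros) (use assms in auto)

text \<open>\<open>esp N\<close> is closed in the space of all sequences, so the closure of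
  \<open>V\<close> stays inside it and the relative frontier can be computed with the ambient
  \<open>closure\<close>.\<close>

lemma frontier_of_Euclidean_space:
  assumes "openin (top_of_set (esp N)) V"
  shows "Euclidean_space N frontier_of V = closure V - V"
proof -
  have "V \<subseteq> esp N" using assms openin_imp_subset by blast
  then have "closure V \<subseteq> esp N" by (simp add: closed_esp closure_minimal)
  have "Euclidean_space N frontier_of V = top_of_set (esp N) closure_of V - V"
    using assms by (simp add: Euclidean_space_eq frontier_of_openin)
  also have "top_of_set (esp N) closure_of V = esp N \<inter> closure V"
    using \<open>V \<subseteq> esp N\<close> by (simp add: closure_of_subtopology inf.absorb2)
  finally show ?thesis using \<open>closure V \<subseteq> esp N\<close> by auto
qed

section \<open>Stereographic coordinates on the sphere\<close>

lemma north_pole_in_sph: "north_pole N \<in> sph N"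
proof -
  have "(\<Sum>i\<le>N. (north_pole N i)\<^sup>2) = (\<Sum>i\<le>N. if i = N then 1 else 0)"
    by (intro sum.cong) (auto simp: north_pole_def)
  then show ?thesis by (simp add: sph_def north_pole_def)
qed

lemma sph_enorm: "s \<in> sph N \<longleftrightarrow> (enorm N s)\<^sup>2 + (s N)\<^sup>2 = 1 \<and> (\<forall>i>N. s i = 0)"
  unfolding sph_def enorm_sq by (simp add: lessThan_Suc_atMost[symmetric])

lemma sph_less_1:
  assumes "s \<in> sph N" "s \<noteq> north_pole N"
  shows "s N < 1"
proof -
  have eq: "(enorm N s)\<^sup>2 + (s N)\<^sup>2 = 1" "\<forall>i>N. s i = 0" using assms by (auto simp: sph_enorm)
  then have "(s N)\<^sup>2 \<le> 1" by (metis le_add_same_cancel2 zero_le_power2)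
  then have "s N \<le> 1" by (metis abs_le_square_iff abs_le_iff abs_one one_power2)
  moreover have "s N \<noteq> 1"
  proof
    assume "s N = 1"
    with eq have "enorm N s = 0" by simp
    then have "s = north_pole N"
      using eq \<open>s N = 1\<close> by (auto simp: north_pole_def enorm_eq_0 fun_eq_iff) (metis linorder_neqE_nat)
    with assms show False by simp
  qed
  ultimately show ?thesis by simp
qed

lemma stereo_in_esp: "stereo N s \<in> esp N"
  by (simp add: stereo_def esp_def)

lemma continuous_on_stereo: "continuous_on {s. s N \<le> c} (stereo N)" if "c < 1"
proof (rule continuous_on_coordinatewise_then_product)
  fix i
  show "continuous_on {s. s N \<le> c} (\<lambda>s. stereo N s i)"
    unfolding stereo_def using that
    by (cases "i < N") (auto intro!: continuous_intros continuous_on_subset[OF continuous_on_product_coordinates])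
qed

text \<open>On the sphere the squared norm of the first \<open>N\<close> coordinates is (1 - s N)(1
  + s N). The formula turns a bound on the projected point into a bound on the height
  \<open>s N\<close>, that is, into a distance from the pole.\<close>

lemma enorm_stereo:
  assumes "s \<in> sph N" "s N < 1"
  shows "(enorm N (stereo N s))\<^sup>2 = (1 + s N) / (1 - s N)"
proof -
  have "enorm N (stereo N s) = enorm N (\<lambda>i. inverse (1 - s N) * s i)"
    unfolding enorm_def stereo_def by (simp add: divide_inverse mult.commute)
  then have "(enorm N (stereo N s))\<^sup>2 = (inverse (1 - s N))\<^sup>2 * (enorm N s)\<^sup>2"
    using assms(2) by (simp add: enorm_scale power_mult_distrib)
  also have "(enorm N s)\<^sup>2 = (1 - s N) * (1 + s N)"
    using assms(1) by (simp add: sph_enorm algebra_simps power2_eq_square)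
  also have "(inverse a)\<^sup>2 * (a * b) = b / a" if "a \<noteq> 0" for a b :: real
    using that by (simp add: divide_simps power2_eq_square)
  finally show ?thesis using assms(2) by simp
qed

text \<open>The point with homogeneous coordinates \<open>(v, \<delta>)\<close>, i.e. \<open>inv_stereo N (v / \<delta>)\<close>, extended
  continuously to \<open>\<delta> = 0\<close> by the point at infinity.\<close>

definition hstereo :: "nat \<Rightarrow> (nat \<Rightarrow> real) \<Rightarrow> real \<Rightarrow> nat \<Rightarrow> real" where
  "hstereo N v \<delta> =
     (\<lambda>i. if i < N then 2 * v i * \<delta> / ((enorm N v)\<^sup>2 + \<delta>\<^sup>2)
          else if i = N then ((enorm N v)\<^sup>2 - \<delta>\<^sup>2) / ((enorm N v)\<^sup>2 + \<delta>\<^sup>2)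
          else 0)"

lemma hstereo_eq_inv_stereo:
  assumes "\<delta> > 0"
  shows "inv_stereo N (\<lambda>i. v i / \<delta>) = hstereo N v \<delta>"
proof -
  have "enorm N (\<lambda>i. v i / \<delta>) = enorm N v / \<delta>"
    using enorm_scale[of N "1 / \<delta>" v] assms by simp
  moreover have "(enorm N v)\<^sup>2 + \<delta>\<^sup>2 > 0" using assms by (simp add: add_nonneg_pos)
  moreover have "((enorm N v) / \<delta>)\<^sup>2 + 1 = ((enorm N v)\<^sup>2 + \<delta>\<^sup>2) / \<delta>\<^sup>2"
    "((enorm N v) / \<delta>)\<^sup>2 - 1 = ((enorm N v)\<^sup>2 - \<delta>\<^sup>2) / \<delta>\<^sup>2"
    using assms by (auto simp: field_simps)
  ultimately show ?thesis
    using assms unfolding inv_stereo_def hstereo_def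
    by (auto simp: fun_eq_iff power2_eq_square)
qed

lemma hstereo_0: "enorm N v \<noteq> 0 \<Longrightarrow> hstereo N v 0 = north_pole N"
  by (auto simp: hstereo_def north_pole_def)

lemma hstereo_in_sph:
  assumes "enorm N v \<noteq> 0 \<or> \<delta> \<noteq> 0"
  shows "hstereo N v \<delta> \<in> sph N"
proof -
  define d where "d = (enorm N v)\<^sup>2 + \<delta>\<^sup>2"
  have "d \<noteq> 0" using assms by (auto simp: d_def sum_power2_eq_zero_iff)
  have "enorm N (hstereo N v \<delta>) = \<bar>2 * \<delta> / d\<bar> * enorm N v"
    unfolding enorm_scale[symmetric] enorm_def[of N "hstereo N v \<delta>"] enorm_def[of N "\<lambda>i. (2 * \<delta> / d) * v i"]
    by (intro arg_cong[where f = sqrt] sum.cong) (auto simp: hstereo_def d_def mult_ac)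
  then have "(enorm N (hstereo N v \<delta>))\<^sup>2 = (2 * \<delta> / d)\<^sup>2 * (enorm N v)\<^sup>2"
    by (simp only: power_mult_distrib power2_abs)
  moreover have "hstereo N v \<delta> N = ((enorm N v)\<^sup>2 - \<delta>\<^sup>2) / d"
    by (simp add: hstereo_def d_def)
  moreover have "(2 * \<delta> / d)\<^sup>2 * (enorm N v)\<^sup>2 + (((enorm N v)\<^sup>2 - \<delta>\<^sup>2) / d)\<^sup>2 =
      ((2 * \<delta>)\<^sup>2 * (enorm N v)\<^sup>2 + ((enorm N v)\<^sup>2 - \<delta>\<^sup>2)\<^sup>2) / d\<^sup>2"
    by (simp add: power_divide add_divide_distrib)
  moreover have "(2 * \<delta>)\<^sup>2 * (enorm N v)\<^sup>2 + ((enorm N v)\<^sup>2 - \<delta>\<^sup>2)\<^sup>2 = d\<^sup>2"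
    by (simp add: d_def power2_eq_square algebra_simps)
  moreover have "\<forall>i>N. hstereo N v \<delta> i = 0" by (simp add: hstereo_def)
  ultimately show ?thesis
    using \<open>d \<noteq> 0\<close> by (simp add: sph_enorm)
qed

lemma continuous_on_hstereo:
  assumes "\<And>i. i < N \<Longrightarrow> continuous_on S (\<lambda>z. v z i)" "continuous_on S \<delta>"
    and "\<And>z. z \<in> S \<Longrightarrow> enorm N (v z) \<noteq> 0 \<or> \<delta> z \<noteq> 0"
  shows "continuous_on S (\<lambda>z. hstereo N (v z) (\<delta> z))"
proof (rule continuous_on_coordinatewise_then_product)
  fix i
  have "(enorm N (v z))\<^sup>2 + (\<delta> z)\<^sup>2 \<noteq> 0" if "z \<in> S" for z
    using assms(3)[OF that] by (auto simp: sum_power2_eq_zero_iff)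
  then show "continuous_on S (\<lambda>z. hstereo N (v z) (\<delta> z) i)"
    unfolding hstereo_def using assms(1,2)
    by (cases "i < N"; cases "i = N") (auto intro!: continuous_intros)
qed

text \<open>\<open>sphere_map\<close> with the radius \<open>r\<close> decoupled from \<open>boundary_dist\<close> and the target point moved
  to the origin, so that radius, map and target can vary independently in a homotopy.\<close>

definition collapse ::
  "nat \<Rightarrow> real \<Rightarrow> (nat \<Rightarrow> real) set \<Rightarrow> ((nat \<Rightarrow> real) \<Rightarrow> nat \<Rightarrow> real) \<Rightarrow> (nat \<Rightarrow> real) \<Rightarrow> nat \<Rightarrow> real"
  where
  "collapse N r V u s =
     (if s \<noteq> north_pole N \<and> stereo N s \<in> V \<and> enorm N (u (stereo N s)) < r
      then inv_stereo N (\<lambda>i. u (stereo N s) i / (r - enorm N (u (stereo N s))))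
      else north_pole N)"

lemma sphere_map_eq_collapse:
  "sphere_map N g V y = collapse N (boundary_dist N g V y) V (\<lambda>x i. g x i - y i)"
  by (simp add: fun_eq_iff sphere_map_def collapse_def Let_def)

lemma collapse_in_sph: "collapse N r V u s \<in> sph N"
  by (auto simp: collapse_def north_pole_in_sph hstereo_eq_inv_stereo intro!: hstereo_in_sph)

text \<open>The sphere is the union of the closed sets \<open>K\<close> (points over the closure of \<open>V\<close>) and \<open>C\<close>
  (points not over \<open>V\<close>). On \<open>K\<close> the map is \<open>hstereo\<close> with \<open>\<delta>\<close> the positive part of the distance
  to the radius, on \<open>C\<close> it is constant; boundedness of \<open>V\<close> keeps \<open>K\<close> away from the pole.\<close>

lemma continuous_on_collapse:
  fixes u :: "real \<Rightarrow> (nat \<Rightarrow> real) \<Rightarrow> nat \<Rightarrow> real"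
  assumes V: "openin (top_of_set (esp N)) V" and R: "\<And>x. x \<in> V \<Longrightarrow> enorm N x \<le> R"
    and u: "\<And>i. i < N \<Longrightarrow> continuous_on (T \<times> closure V) (\<lambda>z. u (fst z) (snd z) i)"
    and \<rho>: "continuous_on T \<rho>" "\<And>t. t \<in> T \<Longrightarrow> \<rho> t > 0"
    and bd: "\<And>t z. t \<in> T \<Longrightarrow> z \<in> closure V - V \<Longrightarrow> \<rho> t \<le> enorm N (u t z)"
    and T: "closed T"
  shows "continuous_on (T \<times> sph N) (\<lambda>z. collapse N (\<rho> (fst z)) V (u (fst z)) (snd z))"
proof -
  \<comment> \<open>The height \<open>c\<close> solves (1 + c) / (1 - c) = M, so it is the height of
    the points over the sphere of squared radius \<open>M\<close>. Taking \<open>M\<close> larger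
    than the square of \<open>R\<close> puts the points over \<open>V\<close> strictly below
    \<open>c\<close>, so the closed cap from height \<open>c\<close> upwards contains none of
    them.\<close>
  define M where "M = R\<^sup>2 + 1"
  define c where "c = (M - 1) / (M + 1)"
  have "M > 0" by (simp add: M_def add_nonneg_pos)
  then have "c < 1" by (simp add: c_def)
  have less_c: "s N < c" if "s \<in> sph N" "s \<noteq> north_pole N" "stereo N s \<in> V" for s
  proof -
    have s1: "s N < 1" using that sph_less_1 by blast
    have "(enorm N (stereo N s))\<^sup>2 \<le> R\<^sup>2"
      using R[OF that(3)] enorm_nonneg power_mono by blast
    then have "(1 + s N) / (1 - s N) < M" using enorm_stereo[OF that(1) s1] by (simp add: M_def)
    then have "1 + s N < M * (1 - s N)" using s1 by (simp add: field_simps)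
    then show ?thesis using \<open>M > 0\<close> by (simp add: c_def field_simps)
  qed
  define S where "S = sph N \<inter> {s. s N \<le> c}"
  have "closed S" unfolding S_def
    by (intro closed_Int closed_sph closed_Collect_le continuous_intros continuous_on_product_coordinates)
  have st: "continuous_on S (stereo N)"
    using continuous_on_stereo[OF \<open>c < 1\<close>] by (rule continuous_on_subset) (auto simp: S_def)
  define K where "K = S \<inter> stereo N -` closure V"
  define C where "C = (S \<inter> stereo N -` (esp N - V)) \<union> (sph N \<inter> {s. c \<le> s N})"
  have "closed K" unfolding K_def by (intro continuous_closed_preimage st \<open>closed S\<close> closed_closure)
  have "closed (esp N - V)"
    using V closed_esp by (metis closedin_closed_trans closedin_diff closedin_subtopology_refl topspace_euclidean_subtopology closedin_topspace)
  moreover have "closed (sph N \<inter> {s. c \<le> s N})"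
    by (intro closed_Int closed_sph closed_Collect_le continuous_intros continuous_on_product_coordinates)
  ultimately have "closed C" unfolding C_def
    by (intro closed_Un continuous_closed_preimage st \<open>closed S\<close>)
  have sph: "sph N = K \<union> C"
  proof -
    have "stereo N s \<in> V \<Longrightarrow> stereo N s \<in> closure V" for s using closure_subset by blast
    then show ?thesis using stereo_in_esp by (auto simp: K_def C_def S_def)
  qed
  let ?F = "\<lambda>z. collapse N (\<rho> (fst z)) V (u (fst z)) (snd z)"
  let ?v = "\<lambda>z. u (fst z) (stereo N (snd z))"
  let ?\<delta> = "\<lambda>z. max 0 (\<rho> (fst z) - enorm N (?v z))"
  have nn: "s \<noteq> north_pole N" if "s \<in> K" for s
    using that \<open>c < 1\<close> by (auto simp: K_def S_def north_pole_def)
  have FK: "?F z = hstereo N (?v z) (?\<delta> z)" if "z \<in> T \<times> K" for z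
  proof (cases "stereo N (snd z) \<in> V \<and> enorm N (?v z) < \<rho> (fst z)")
    case True
    then show ?thesis using nn[of "snd z"] that
      by (auto simp: collapse_def hstereo_eq_inv_stereo max_def)
  next
    case False
    \<comment> \<open>A point of \<open>K\<close> not over \<open>V\<close> lies over its frontier,
      where \<open>bd\<close> applies. In both cases the positive part is 0 while the vector is
      nonzero, so \<open>hstereo\<close> gives the pole.\<close>
    have "\<rho> (fst z) \<le> enorm N (?v z)"
    proof (cases "stereo N (snd z) \<in> V")
      case False
      then show ?thesis using that bd by (auto simp: K_def)
    qed (use False in auto)
    moreover have "\<rho> (fst z) > 0" using \<rho> that by auto
    ultimately show ?thesis using False by (auto simp: collapse_def hstereo_0 max_def)
  qed
  have "continuous_on (T \<times> K) (\<lambda>z. hstereo N (?v z) (?\<delta> z))"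
  proof (rule continuous_on_hstereo)
    have pair: "continuous_on (T \<times> K) (\<lambda>z. (fst z, stereo N (snd z)))"
      by (intro continuous_intros continuous_on_compose2[OF st]) (auto simp: K_def)
    show v: "continuous_on (T \<times> K) (\<lambda>z. ?v z i)" if "i < N" for i
    proof -
      have "(\<lambda>z. (fst z, stereo N (snd z))) ` (T \<times> K) \<subseteq> T \<times> closure V"
        by (auto simp: K_def)
      from continuous_on_compose2[OF u[OF that] pair this] show ?thesis by simp
    qed
    show "continuous_on (T \<times> K) ?\<delta>"
      by (intro continuous_intros v continuous_on_compose2[OF \<rho>(1)]) auto
    show "enorm N (?v z) \<noteq> 0 \<or> ?\<delta> z \<noteq> 0" if "z \<in> T \<times> K" for z
      using \<rho>(2) that by (force simp: max_def)
  qed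
  then have 1: "continuous_on (T \<times> K) ?F"
    using FK by (simp cong: continuous_on_cong)
  have FC: "?F z = north_pole N" if "z \<in> T \<times> C" for z
    using that less_c[of "snd z"] by (force simp: collapse_def C_def)
  have 2: "continuous_on (T \<times> C) ?F"
    using FC by (simp cong: continuous_on_cong)
  have "T \<times> sph N = T \<times> K \<union> T \<times> C" using sph by auto
  with 1 2 T \<open>closed K\<close> \<open>closed C\<close> show ?thesis
    by (simp add: continuous_on_closed_Un closed_Times)
qed

lemma nsphere_homotopy_degree:
  fixes F :: "real \<Rightarrow> (nat \<Rightarrow> real) \<Rightarrow> nat \<Rightarrow> real"
  assumes "continuous_on ({0..1} \<times> sph N) (\<lambda>z. F (fst z) (snd z))"
    and "\<And>t s. t \<in> {0..1} \<Longrightarrow> s \<in> sph N \<Longrightarrow> F t s \<in> sph N"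
  shows "Brouwer_degree2 N (F 0) = Brouwer_degree2 N (F 1)"
proof (rule Brouwer_degree2_homotopic)
  show "homotopic_with (\<lambda>x. True) (nsphere N) (nsphere N) (F 0) (F 1)"
    unfolding nsphere_eq homotopic_with_def prod_topology_subtopology_eu
    using assms by (intro exI[of _ "\<lambda>z. F (fst z) (snd z)"]) (auto simp: Pi_iff)
qed

lemma collapse_degree_homotopy:
  fixes u :: "real \<Rightarrow> (nat \<Rightarrow> real) \<Rightarrow> nat \<Rightarrow> real"
  assumes "openin (top_of_set (esp N)) V" "\<And>x. x \<in> V \<Longrightarrow> enorm N x \<le> R"
    and "\<And>i. i < N \<Longrightarrow> continuous_on ({0..1} \<times> closure V) (\<lambda>z. u (fst z) (snd z) i)"
    and "continuous_on {0..1} \<rho>" "\<And>t. t \<in> {0..1} \<Longrightarrow> \<rho> t > 0"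
    and "\<And>t z. t \<in> {0..1} \<Longrightarrow> z \<in> closure V - V \<Longrightarrow> \<rho> t \<le> enorm N (u t z)"
  shows "Brouwer_degree2 N (collapse N (\<rho> 0) V (u 0)) = Brouwer_degree2 N (collapse N (\<rho> 1) V (u 1))"
  using continuous_on_collapse[of N V R "{0..1}" u \<rho>] assms
  by (intro nsphere_homotopy_degree[of N "\<lambda>t. collapse N (\<rho> t) V (u t)"]) (auto simp: collapse_in_sph)

section \<open>Homotopy invariance and normalization of the degree\<close>

text \<open>The ambient sequence space is infinite-dimensional, so boundedness alone gives nothing.
  Compactness comes from Tychonoff: \<open>V\<close> lies in a product of intervals whose factors
  from index \<open>N\<close> on are the single point 0.\<close>

lemma compact_closure_bounded_esp:
  assumes "V \<subseteq> esp N" and "\<And>x. x \<in> V \<Longrightarrow> enorm N x \<le> R"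
  shows "compact (closure V)"
proof -
  define K where "K = (\<Pi>\<^sub>E i\<in>UNIV. if i < N then {-R..R} else {0::real})"
  have "compactin (product_topology (\<lambda>i::nat. euclidean) UNIV) K"
    unfolding K_def by (subst compactin_PiE) auto
  then have "compact K"
    by (simp add: euclidean_product_topology)
  moreover have "V \<subseteq> K"
  proof
    fix x assume x: "x \<in> V"
    have "\<bar>x i\<bar> \<le> R" if "i < N" for i
      using member_le_L2_set[of "{..<N}" i "\<lambda>i. \<bar>x i\<bar>"] that assms(2)[OF x]
      by (simp add: enorm_L2_set) (simp add: L2_set_def)
    with x assms(1) show "x \<in> K"
      by (fastforce simp: K_def PiE_UNIV_domain Pi_iff esp_def abs_le_iff)
  qed
  ultimately have "closure V \<subseteq> K" by (simp add: closure_minimal compact_imp_closed)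
  then have "closure V = K \<inter> closure V" by blast
  then show ?thesis using \<open>compact K\<close> by (metis closed_closure compact_Int_closed)
qed

lemma compact_frontier_bounded_esp:
  assumes V: "openin (top_of_set (esp N)) V" and R: "\<And>x. x \<in> V \<Longrightarrow> enorm N x \<le> R"
  shows "compact (closure V - V)"
proof -
  have VE: "V \<subseteq> esp N" using V openin_imp_subset by blast
  then have "closure V \<subseteq> esp N" using closed_esp by (rule closure_minimal)
  then have "closure V - V = closure V \<inter> (esp N - V)" by auto
  moreover have "closed (esp N - V)"
    using V closed_esp by (metis closedin_closed_trans closedin_diff topspace_euclidean_subtopology closedin_topspace)
  ultimately show ?thesis
    using compact_closure_bounded_esp[OF VE R] by (simp add: compact_Int_closed)
qed

lemma boundary_dist_le:
  assumes "openin (top_of_set (esp N)) V" "z \<in> closure V - V"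
  shows "boundary_dist N g V y \<le> enorm N (\<lambda>i. g z i - y i)"
  unfolding boundary_dist_def frontier_of_Euclidean_space[OF assms(1)]
  by (rule cINF_lower[OF _ assms(2)]) (auto intro!: bdd_belowI[of _ 0] enorm_nonneg)

text \<open>Over an empty frontier the infimum has no usable value; this is why nonemptiness of the
  frontier is carried through the degree lemmas.\<close>

lemma boundary_dist_ge:
  assumes "openin (top_of_set (esp N)) V" "closure V - V \<noteq> {}"
    and "\<And>z. z \<in> closure V - V \<Longrightarrow> r \<le> enorm N (\<lambda>i. g z i - y i)"
  shows "r \<le> boundary_dist N g V y"
  unfolding boundary_dist_def frontier_of_Euclidean_space[OF assms(1)]
  by (rule cINF_greatest) (use assms in auto)

text \<open>Continuity of \<open>boundary_dist\<close> in \<open>t\<close> is avoided. Compactness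
  of the frontier times the unit interval gives one radius \<open>r\<close> valid for all
  \<open>t\<close>. At each end the radius is moved linearly to \<open>r\<close> with the map held
  fixed, and the map is deformed with the radius held at \<open>r\<close>.\<close>

lemma brouwer_deg_homotopy:
  fixes h :: "real \<Rightarrow> (nat \<Rightarrow> real) \<Rightarrow> nat \<Rightarrow> real"
  assumes V: "openin (top_of_set (esp N)) V" "closure V - V \<noteq> {}"
    and R: "\<And>x. x \<in> V \<Longrightarrow> enorm N x \<le> R"
    and h: "\<And>i. i < N \<Longrightarrow> continuous_on ({0..1} \<times> closure V) (\<lambda>z. h (fst z) (snd z) i)"
    and y: "\<And>t z. t \<in> {0..1} \<Longrightarrow> z \<in> closure V - V \<Longrightarrow> \<exists>i<N. h t z i \<noteq> y i"
  shows "brouwer_deg N (h 0) V y = brouwer_deg N (h 1) V y"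
proof -
  define u where "u = (\<lambda>t x i. h t x i - y i)"
  have K: "compact ({0..1::real} \<times> (closure V - V))"
    by (intro compact_Times compact_frontier_bounded_esp[OF V(1) R]) auto
  have ne: "{0..1::real} \<times> (closure V - V) \<noteq> {}" using V(2) by auto
  have u: "continuous_on ({0..1} \<times> closure V) (\<lambda>z. u (fst z) (snd z) i)" if "i < N" for i
    unfolding u_def by (intro continuous_intros h that)
  have ce: "continuous_on ({0..1} \<times> (closure V - V)) (\<lambda>z. enorm N (u (fst z) (snd z)))"
    by (intro continuous_on_enorm continuous_on_subset[OF u]) auto
  obtain a where a: "a \<in> {0..1} \<times> (closure V - V)"
    and min: "\<And>z. z \<in> {0..1} \<times> (closure V - V) \<Longrightarrow>
      enorm N (u (fst a) (snd a)) \<le> enorm N (u (fst z) (snd z))"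
    using continuous_attains_inf[OF K ne ce] by blast
  define r where "r = enorm N (u (fst a) (snd a))"
  have "enorm N (u (fst a) (snd a)) \<noteq> 0"
    using y[of "fst a" "snd a"] a by (auto simp: enorm_eq_0 u_def)
  then have "r > 0" using enorm_nonneg[of N] by (simp add: r_def less_le)
  have r: "r \<le> enorm N (u t z)" if "t \<in> {0..1}" "z \<in> closure V - V" for t z
    using min[of "(t, z)"] that by (simp add: r_def)
  define d where "d t = boundary_dist N (h t) V y" for t
  have d: "r \<le> d t" "z \<in> closure V - V \<Longrightarrow> d t \<le> enorm N (u t z)" if "t \<in> {0..1}" for t z
    unfolding d_def u_def using boundary_dist_ge[OF V] boundary_dist_le[OF V(1)] r[OF that]
    by (auto simp: u_def)
  have step: "Brouwer_degree2 N (collapse N (d c) V (u c)) = Brouwer_degree2 N (collapse N r V (u c))"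
    if c: "c \<in> {0..1}" for c
  proof -
    define \<rho> where "\<rho> t = (1 - t) * d c + t * r" for t
    have \<rho>: "r \<le> \<rho> t" "\<rho> t \<le> d c" if "t \<in> {0..1}" for t
    proof -
      have "t * r \<le> t * d c" "(1 - t) * r \<le> (1 - t) * d c"
        using that d(1)[OF c] by (auto intro!: mult_left_mono)
      then show "r \<le> \<rho> t" "\<rho> t \<le> d c" by (auto simp: \<rho>_def algebra_simps)
    qed
    have "Brouwer_degree2 N (collapse N (\<rho> 0) V (u c)) = Brouwer_degree2 N (collapse N (\<rho> 1) V (u c))"
    proof (rule collapse_degree_homotopy[OF V(1) R, where u = "\<lambda>t. u c"])
      show "continuous_on ({0..1::real} \<times> closure V) (\<lambda>z. u c (snd z) i)" if "i < N" for i
      proof -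
        have 1: "continuous_on ({0..1::real} \<times> closure V) (\<lambda>z. (c, snd z))"
          by (intro continuous_intros)
        have 2: "(\<lambda>z. (c, snd z)) ` ({0..1::real} \<times> closure V) \<subseteq> {0..1} \<times> closure V"
          using c by auto
        from continuous_on_compose2[OF u[OF that] 1 2] show ?thesis by simp
      qed
      show "continuous_on {0..1} \<rho>" unfolding \<rho>_def by (intro continuous_intros)
      show "\<rho> t > 0" if "t \<in> {0..1}" for t using \<rho>[OF that] \<open>r > 0\<close> by simp
      show "\<rho> t \<le> enorm N (u c z)" if "t \<in> {0..1}" "z \<in> closure V - V" for t z
        using \<rho>(2)[OF that(1)] d(2)[OF c that(2)] by (rule order_trans)
    qed
    then show ?thesis by (simp add: \<rho>_def)
  qed
  have "Brouwer_degree2 N (collapse N r V (u 0)) = Brouwer_degree2 N (collapse N r V (u 1))"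
    by (rule collapse_degree_homotopy[OF V(1) R u, where \<rho> = "\<lambda>_. r"]) (use \<open>r > 0\<close> r in auto)
  with step[of 0] step[of 1] show ?thesis
    by (simp add: brouwer_deg_def sphere_map_eq_collapse d_def u_def)
qed

text \<open>The segment from \<open>f s\<close> to \<open>s\<close> meets the origin only if the two
  unit vectors are antipodal, and then only at its midpoint. Normalizing the segment therefore gives
  a homotopy to the identity. The norm has index \<open>Suc N\<close> because the sphere uses the
  coordinates 0 to \<open>N\<close>.\<close>

lemma non_antipodal_degree_1:
  assumes cont: "continuous_on (sph N) f" and f: "\<And>s. s \<in> sph N \<Longrightarrow> f s \<in> sph N"
    and na: "\<And>s. s \<in> sph N \<Longrightarrow> f s \<noteq> (\<lambda>i. - s i)"
  shows "Brouwer_degree2 N f = 1"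
proof -
  define w where "w = (\<lambda>t s i. (1 - t) * f s i + t * (s i :: real))"
  define F where "F = (\<lambda>t s i. w t s i / enorm (Suc N) (w t s))"
  have sph1: "s \<in> sph N \<longleftrightarrow> enorm (Suc N) s = 1 \<and> (\<forall>i>N. s i = 0)" for s
  proof -
    have "enorm (Suc N) s = 1 \<longleftrightarrow> (enorm (Suc N) s)\<^sup>2 = 1"
      using enorm_nonneg[of "Suc N" s] by (auto simp: power2_eq_1_iff)
    also have "(enorm (Suc N) s)\<^sup>2 = (\<Sum>i\<le>N. (s i)\<^sup>2)"
      by (simp only: enorm_sq lessThan_Suc_atMost)
    finally show ?thesis by (simp add: sph_def)
  qed
  have w0: "enorm (Suc N) (w t s) \<noteq> 0" if t: "t \<in> {0..1}" and s: "s \<in> sph N" for t s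
  proof
    assume "enorm (Suc N) (w t s) = 0"
    then have "(1 - t) * f s i + t * s i = 0" for i
      using s f[OF s] by (cases "i \<le> N") (auto simp: enorm_eq_0 w_def sph_def)
    then have z: "(1 - t) * f s i = - t * s i" for i by (simp add: eq_neg_iff_add_eq_0)
    then have "enorm (Suc N) (\<lambda>i. (1 - t) * f s i) = enorm (Suc N) (\<lambda>i. (- t) * s i)" by simp
    then have "1 - t = t" using t s f[OF s] unfolding enorm_scale by (simp add: sph1)
    then have "t = 1 / 2" by simp
    have "f s i = - s i" for i using z[of i] unfolding \<open>t = 1 / 2\<close> by simp
    then show False using na[OF s] by auto
  qed
  have "Brouwer_degree2 N (F 0) = Brouwer_degree2 N (F 1)"
  proof (rule nsphere_homotopy_degree)
    have sn: "continuous_on ({0..1::real} \<times> sph N) snd" by (intro continuous_intros)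
    have "continuous_on ({0..1::real} \<times> sph N) (\<lambda>z. f (snd z))"
      by (rule continuous_on_compose2[OF cont sn]) auto
    then have "continuous_on ({0..1::real} \<times> sph N) (\<lambda>z. f (snd z) i)" for i
      by (rule continuous_on_product_then_coordinatewise)
    moreover have "continuous_on ({0..1::real} \<times> sph N) (\<lambda>z. snd z i)" for i
      using sn by (rule continuous_on_product_then_coordinatewise)
    ultimately have "continuous_on ({0..1} \<times> sph N) (\<lambda>z. w (fst z) (snd z) i)" for i
      unfolding w_def by (intro continuous_intros)
    then show "continuous_on ({0..1} \<times> sph N) (\<lambda>z. F (fst z) (snd z))"
      unfolding F_def using w0
      by (intro continuous_on_coordinatewise_then_product continuous_on_divide continuous_on_enorm) auto
    show "F t s \<in> sph N" if "t \<in> {0..1}" "s \<in> sph N" for t s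
    proof -
      have "enorm (Suc N) (F t s) = 1"
        using w0[OF that] enorm_nonneg[of "Suc N" "w t s"]
          enorm_scale[of "Suc N" "inverse (enorm (Suc N) (w t s))" "w t s"]
        by (simp add: F_def divide_inverse mult.commute)
      then show ?thesis using that f[of s] by (auto simp: sph1 F_def w_def)
    qed
  qed
  also have "Brouwer_degree2 N (F 0) = Brouwer_degree2 N f"
    using f by (intro Brouwer_degree2_eq) (auto simp: F_def w_def nsphere_eq sph1)
  also have "Brouwer_degree2 N (F 1) = Brouwer_degree2 N id"
    by (intro Brouwer_degree2_eq) (auto simp: F_def w_def nsphere_eq sph1)
  finally show ?thesis by simp
qed

lemma enorm_triangle: "enorm N (\<lambda>i. x i + y i) \<le> enorm N x + enorm N y"
  unfolding enorm_L2_set by (rule L2_set_triangle_ineq)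

text \<open>If \<open>x\<close> were outside \<open>V\<close>, the segment from \<open>y\<close> to
  \<open>x\<close> would be a connected set meeting the frontier, at a point no farther from
  \<open>y\<close> than \<open>x\<close> itself.\<close>

lemma ball_subset_open:
  assumes V: "openin (top_of_set (esp N)) V" and y: "y \<in> V" and x: "x \<in> esp N"
    and lt: "\<And>z. z \<in> closure V - V \<Longrightarrow> enorm N (\<lambda>i. x i - y i) < enorm N (\<lambda>i. z i - y i)"
  shows "x \<in> V"
proof (rule ccontr)
  assume "x \<notin> V"
  have "y \<in> esp N" using V y openin_imp_subset by blast
  define p where "p = (\<lambda>t i. y i + t * (x i - y i))"
  have "continuous_on {0..1::real} p"
    unfolding p_def by (intro continuous_on_coordinatewise_then_product continuous_intros)
  then have "connected (p ` {0..1})" by (simp add: connected_continuous_image)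
  moreover have "p ` {0..1} \<subseteq> esp N" using x \<open>y \<in> esp N\<close> by (auto simp: p_def esp_def)
  ultimately have "connectedin (top_of_set (esp N)) (p ` {0..1})"
    by (simp add: connectedin_subtopology)
  moreover have "y \<in> p ` {0..1}" "x \<in> p ` {0..1}"
    by (auto simp: p_def image_iff intro: bexI[of _ 0] bexI[of _ 1])
  ultimately obtain t where t: "t \<in> {0..1}" "p t \<in> top_of_set (esp N) frontier_of V"
    using connectedin_Int_frontier_of[of "top_of_set (esp N)" "p ` {0..1}" V] y \<open>x \<notin> V\<close> by blast
  then have "p t \<in> closure V - V"
    using frontier_of_Euclidean_space[OF V] by (simp add: Euclidean_space_eq)
  from lt[OF this] have "enorm N (\<lambda>i. x i - y i) < \<bar>t\<bar> * enorm N (\<lambda>i. x i - y i)"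
    by (simp add: p_def flip: enorm_scale)
  also have "\<dots> \<le> enorm N (\<lambda>i. x i - y i)"
    using t(1) enorm_nonneg[of N "\<lambda>i. x i - y i"] by (auto intro: mult_left_le_one_le)
  finally show False by simp
qed

text \<open>Excision replaces \<open>V\<close> by a ball around the origin, inside which \<open>y\<close> can be moved to the
  origin; the resulting collapse map preserves rays, so it takes no point to its antipode.\<close>

lemma brouwer_deg_id:
  assumes V: "openin (top_of_set (esp N)) V" "closure V - V \<noteq> {}"
    and R: "\<And>x. x \<in> V \<Longrightarrow> enorm N x \<le> R" and y: "y \<in> V"
  shows "brouwer_deg N (\<lambda>x. x) V y = 1"
proof -
  have VE: "V \<subseteq> esp N" using V(1) openin_imp_subset by blast
  define r where "r = boundary_dist N (\<lambda>x. x) V y"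
  have rle: "r \<le> enorm N (\<lambda>i. z i - y i)" if "z \<in> closure V - V" for z
    unfolding r_def by (rule boundary_dist_le[OF V(1) that])
  have "r > 0"
  proof -
    have "closure V \<subseteq> esp N" using VE closed_esp by (rule closure_minimal)
    have ce: "continuous_on (closure V - V) (\<lambda>z. enorm N (\<lambda>i. z i - y i))"
      by (intro continuous_intros) (auto intro: continuous_on_subset[OF continuous_on_product_coordinates])
    obtain a where a: "a \<in> closure V - V"
      "\<And>z. z \<in> closure V - V \<Longrightarrow> enorm N (\<lambda>i. a i - y i) \<le> enorm N (\<lambda>i. z i - y i)"
      using continuous_attains_inf[OF compact_frontier_bounded_esp[OF V(1) R] V(2) ce] by blast
    have "a \<in> esp N" "y \<in> esp N" using a(1) y VE \<open>closure V \<subseteq> esp N\<close> by auto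
    have "a \<noteq> y" using a y by auto
    then obtain i where "a i \<noteq> y i" by auto
    with \<open>a \<in> esp N\<close> \<open>y \<in> esp N\<close> have "i < N"
      by (simp add: esp_def) (metis not_le)
    with \<open>a i \<noteq> y i\<close> have "enorm N (\<lambda>i. a i - y i) \<noteq> 0" by (auto simp: enorm_eq_0)
    then have "0 < enorm N (\<lambda>i. a i - y i)" using enorm_nonneg[of N] by (simp add: less_le)
    also have "\<dots> \<le> r" unfolding r_def by (rule boundary_dist_ge[OF V a(2)])
    finally show ?thesis .
  qed
  \<comment> \<open>This radius serves twice: the ball \<open>W\<close> contains the
    \<open>r\<close>-ball around \<open>y\<close>, and on the frontier of \<open>W\<close> the
    distance to every point \<open>(1 - t) y\<close> of the moving target is at least
    \<open>r\<close>.\<close>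
  define Q where "Q = enorm N y + r"
  define W where "W = {x \<in> esp N. enorm N x < Q}"
  have cW: "continuous_on UNIV (enorm N)"
    by (intro continuous_on_enorm continuous_on_product_coordinates)
  have W: "openin (top_of_set (esp N)) W"
  proof -
    have "open {x. enorm N x < Q}" by (intro open_Collect_less cW continuous_intros)
    moreover have "W = esp N \<inter> {x. enorm N x < Q}" by (auto simp: W_def)
    ultimately show ?thesis by (auto simp: openin_open)
  qed
  have frW: "enorm N z \<ge> Q" if "z \<in> closure W - W" for z
  proof -
    have "closure W \<subseteq> esp N" using closed_esp by (rule closure_minimal[rotated]) (auto simp: W_def)
    with that show ?thesis by (auto simp: W_def)
  qed
  define u where "u = (\<lambda>(t::real) (x::nat \<Rightarrow> real) i. x i - (1 - t) * y i)"
  \<comment> \<open>Only points of the domain within distance \<open>r\<close> of \<open>y\<close>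
    are not sent to the pole. They form the same set for both domains, by
    \<open>ball_subset_open\<close> for \<open>V\<close> and by the triangle inequality for
    \<open>W\<close>.\<close>
  have "collapse N r V (\<lambda>x i. x i - y i) = collapse N r W (u 0)"
  proof -
    have "x \<in> V \<and> enorm N (\<lambda>i. x i - y i) < r \<longleftrightarrow> x \<in> W \<and> enorm N (\<lambda>i. x i - y i) < r"
      if "x \<in> esp N" for x
    proof -
      have "x \<in> V" if "enorm N (\<lambda>i. x i - y i) < r"
        using ball_subset_open[OF V(1) y \<open>x \<in> esp N\<close>] rle that by force
      moreover have "x \<in> W" if "enorm N (\<lambda>i. x i - y i) < r"
        using enorm_triangle[of N "\<lambda>i. x i - y i" y] \<open>x \<in> esp N\<close> that by (simp add: W_def Q_def)
      ultimately show ?thesis by auto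
    qed
    then show ?thesis
      using stereo_in_esp by (simp add: fun_eq_iff collapse_def u_def)
  qed
  then have "brouwer_deg N (\<lambda>x. x) V y = Brouwer_degree2 N (collapse N r W (u 0))"
    by (simp add: brouwer_deg_def sphere_map_eq_collapse r_def)
  also have "\<dots> = Brouwer_degree2 N (collapse N r W (u 1))"
  proof (rule collapse_degree_homotopy[OF W, where \<rho> = "\<lambda>_. r"])
    show "enorm N x \<le> Q" if "x \<in> W" for x using that by (simp add: W_def)
    show "continuous_on ({0..1::real} \<times> closure W) (\<lambda>z. u (fst z) (snd z) i)" for i
      unfolding u_def by (intro continuous_intros continuous_on_product_then_coordinatewise)
    show "r \<le> enorm N (u t z)" if "t \<in> {0..1}" "z \<in> closure W - W" for t z
    proof -
      have "enorm N z \<le> enorm N (u t z) + \<bar>1 - t\<bar> * enorm N y"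
        using enorm_triangle[of N "u t z" "\<lambda>i. (1 - t) * y i"] by (simp add: u_def enorm_scale)
      also have "\<bar>1 - t\<bar> * enorm N y \<le> enorm N y"
        using that(1) enorm_nonneg[of N y] by (auto intro: mult_left_le_one_le)
      finally show ?thesis using frW[OF that(2)] by (simp add: Q_def)
    qed
  qed (use \<open>r > 0\<close> in auto)
  also have "\<dots> = 1"
  proof (rule non_antipodal_degree_1)
    have c2: "continuous_on ({0..1::real} \<times> sph N) (\<lambda>z. collapse N r W (u 1) (snd z))"
    proof (rule continuous_on_collapse[OF W, where \<rho> = "\<lambda>_. r" and u = "\<lambda>_. u 1"])
      show "enorm N x \<le> Q" if "x \<in> W" for x using that by (simp add: W_def)
      show "continuous_on ({0..1::real} \<times> closure W) (\<lambda>z. u 1 (snd z) i)" for i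
        unfolding u_def by (intro continuous_intros continuous_on_product_then_coordinatewise)
      show "r \<le> enorm N (u 1 z)" if "z \<in> closure W - W" for z
        using frW[OF that] enorm_nonneg[of N y] by (simp add: u_def Q_def)
    qed (use \<open>r > 0\<close> in auto)
    have 1: "continuous_on (sph N) (\<lambda>s. (0::real, s))" by (intro continuous_intros)
    have 2: "(\<lambda>s. (0::real, s)) ` sph N \<subseteq> {0..1} \<times> sph N" by auto
    from continuous_on_compose2[OF c2 1 2] show "continuous_on (sph N) (collapse N r W (u 1))"
      by simp
    fix s assume s: "s \<in> sph N"
    show "collapse N r W (u 1) s \<in> sph N" by (rule collapse_in_sph)
    show "collapse N r W (u 1) s \<noteq> (\<lambda>i. - s i)"
    proof
      assume eq: "collapse N r W (u 1) s = (\<lambda>i. - s i)"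
      let ?x = "stereo N s"
      consider "s = north_pole N" | "s \<noteq> north_pole N" "?x \<in> W" "enorm N ?x < r"
        | "s \<noteq> north_pole N" "\<not> (?x \<in> W \<and> enorm N ?x < r)" by blast
      then show False
      proof cases
        case 1
        with fun_cong[OF eq, of N] show ?thesis by (simp add: collapse_def north_pole_def)
      next
        case 2
        let ?d = "r - enorm N ?x"
        have s1: "s N < 1" using sph_less_1[OF s 2(1)] .
        have "?d > 0" using 2 by simp
        have h: "collapse N r W (u 1) s = hstereo N ?x ?d"
          using 2 \<open>?d > 0\<close> by (simp add: collapse_def u_def hstereo_eq_inv_stereo)
        have D: "(enorm N ?x)\<^sup>2 + ?d\<^sup>2 > 0" using \<open>?d > 0\<close> by (simp add: add_nonneg_pos)
        \<comment> \<open>The first \<open>N\<close> coordinates of the image are positive multiples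
          of those of \<open>s\<close>, so equality with their negatives makes them vanish. Then the
          image is the south pole, and the antipodal equation puts \<open>s\<close> at the excluded
          north pole.\<close>
        have "s i = 0" if "i < N" for i
        proof -
          have "2 * (s i / (1 - s N)) * ?d / ((enorm N ?x)\<^sup>2 + ?d\<^sup>2) = - s i"
            using fun_cong[OF eq, of i] that h by (simp add: hstereo_def stereo_def)
          then have "s i * (2 * ?d / ((1 - s N) * ((enorm N ?x)\<^sup>2 + ?d\<^sup>2)) + 1) = 0"
            by (simp add: field_simps)
          moreover have "2 * ?d / ((1 - s N) * ((enorm N ?x)\<^sup>2 + ?d\<^sup>2)) > 0"
            using D s1 \<open>?d > 0\<close> by simp
          ultimately show ?thesis by simp
        qed
        then have "enorm N ?x = 0" "enorm N s = 0" by (auto simp: enorm_eq_0 stereo_def)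
        then have "s N = 1" using fun_cong[OF eq, of N] h \<open>?d > 0\<close> by (simp add: hstereo_def)
        with s1 show False by simp
      next
        case 3
        then have "(\<lambda>i. - s i) = north_pole N" using eq by (auto simp: collapse_def u_def)
        \<comment> \<open>Here \<open>s\<close> is the south pole, which lies over the origin; but
          the origin belongs to \<open>W\<close> and has norm less than \<open>r\<close>.\<close>
        then have "s i = - north_pole N i" for i by (metis add.inverse_inverse)
        then have "enorm N ?x = 0" by (auto simp: enorm_eq_0 stereo_def north_pole_def)
        with 3 \<open>r > 0\<close> stereo_in_esp show False
          using enorm_nonneg[of N y] by (auto simp: W_def Q_def)
      qed
    qed
  qed
  finally show ?thesis .
qed

section \<open>The degree on symmetric matrices\<close>

lemma subspace_Sym: "subspace (Sym :: (real^'n^'n) set)"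
  by (auto simp: subspace_def Sym_def transpose_def vec_eq_iff)

lemma closed_Sym: "closed (Sym :: (real^'n^'n) set)"
  by (rule closed_subspace[OF subspace_Sym])

type_synonym 'n mtx = "((real, 'n) vec, 'n) vec"

section \<open>Enumeration of the lower triangle\<close>

lemma set_lower_tri: "set (lower_tri :: ('n::{finite,linorder} \<times> 'n) list) = {(i, j). j \<le> i}"
  by (auto simp: lower_tri_def)

lemma length_lower_tri_card:
  "length (lower_tri :: ('n::{finite,linorder} \<times> 'n) list) = card {(i::'n, j). j \<le> i}"
proof -
  have len: "length (filter ((\<le>) j) (sorted_list_of_set UNIV)) = card {i. j \<le> i}" for j :: 'n
    by (simp add: distinct_length_filter Int_def)
  have "length (lower_tri :: ('n \<times> 'n) list) =
      sum_list (map (\<lambda>j::'n. card {i. j \<le> i}) (sorted_list_of_set UNIV))"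
    by (simp add: lower_tri_def length_concat comp_def len)
  also have "\<dots> = (\<Sum>j\<in>UNIV. card {i::'n. j \<le> i})"
    by (simp add: sum_list_distinct_conv_sum_set)
  also have "\<dots> = card (SIGMA j:UNIV. {i::'n. j \<le> i})"
    by (simp add: card_SigmaI)
  also have "\<dots> = card {(i::'n, j). j \<le> i}"
    by (rule bij_betw_same_card[of prod.swap]) (auto simp: bij_betw_def inj_on_def image_iff)
  finally show ?thesis .
qed

text \<open>Transposition exchanges the lower and upper triangles; together they cover the square
  and overlap in the diagonal, so twice the length is n^2 + n.\<close>

lemma length_lower_tri:
  "length (lower_tri :: ('n::{finite,linorder} \<times> 'n) list) = CARD('n) * (CARD('n) + 1) div 2"
proof -
  let ?L = "{(i::'n, j). j \<le> i}" and ?U = "{(i::'n, j). i \<le> j}"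
  have "card ?L = card ?U"
    by (rule bij_betw_same_card[of prod.swap]) (auto simp: bij_betw_def inj_on_def image_iff)
  moreover have "card ?L + card ?U = card (?L \<union> ?U) + card (?L \<inter> ?U)"
    by (rule card_Un_Int) auto
  moreover have "?L \<union> ?U = UNIV" by auto
  moreover have "card (?L \<inter> ?U) = CARD('n)"
  proof -
    have "?L \<inter> ?U = range (\<lambda>i. (i, i))" by auto
    then show ?thesis by (simp add: card_image inj_on_def)
  qed
  ultimately have "2 * card ?L = CARD('n) * CARD('n) + CARD('n)" by simp
  then show ?thesis by (simp add: length_lower_tri_card)
qed

lemma distinct_lower_tri: "distinct (lower_tri :: ('n::{finite,linorder} \<times> 'n) list)"
  by (simp add: card_distinct set_lower_tri length_lower_tri_card)

definition lower_tri_index :: "('n::{finite,linorder}) \<times> 'n \<Rightarrow> nat" where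
  "lower_tri_index = inv_into {..<length (lower_tri :: ('n \<times> 'n) list)} ((!) lower_tri)"

lemma bij_betw_lower_tri:
  "bij_betw ((!) lower_tri) {..<length (lower_tri :: ('n::{finite,linorder} \<times> 'n) list)} {(i::'n, j). j \<le> i}"
  by (rule bij_betw_nth) (auto simp: distinct_lower_tri set_lower_tri)

lemma lower_tri_index:
  assumes "j \<le> i"
  shows "lower_tri_index (i, j) < length (lower_tri :: ('n::{finite,linorder} \<times> 'n) list)"
    and "lower_tri ! lower_tri_index (i, j) = (i, j :: 'n)"
proof -
  have "(i, j) \<in> (!) lower_tri ` {..<length (lower_tri :: ('n \<times> 'n) list)}"
    using bij_betw_lower_tri[where 'n = 'n] assms by (auto simp: bij_betw_def)
  then show "lower_tri_index (i, j) < length (lower_tri :: ('n \<times> 'n) list)"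
    "lower_tri ! lower_tri_index (i, j) = (i, j)"
    unfolding lower_tri_index_def
    using inv_into_into[of "(i, j)" "(!) lower_tri"] f_inv_into_f[of "(i, j)" "(!) lower_tri"]
    by blast+
qed

lemma lower_tri_index_nth:
  "l < length (lower_tri :: ('n::{finite,linorder} \<times> 'n) list) \<Longrightarrow>
    lower_tri_index (lower_tri ! l :: 'n \<times> 'n) = l"
  unfolding lower_tri_index_def
  by (rule bij_betw_inv_into_left[OF bij_betw_lower_tri]) simp

text \<open>An explicit inverse of \<open>vech\<close>, since \<open>unvech\<close> is given only
  through \<open>inv_into\<close>. Continuity and surjectivity of \<open>vech\<close> onto
  \<open>esp\<close> are read off this formula; \<open>max\<close> and \<open>min\<close> select the
  lower triangular position of an unordered pair of indices.\<close>

definition sym_of_vec :: "(nat \<Rightarrow> real) \<Rightarrow> ('n::{finite,linorder}) mtx" where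
  "sym_of_vec x = (\<chi> i j. x (lower_tri_index (max i j, min i j)))"

lemma sym_of_vec_in_Sym: "sym_of_vec x \<in> Sym"
  by (simp add: Sym_def sym_of_vec_def transpose_def max.commute min.commute)

lemma vech_lower_tri_index: "j \<le> i \<Longrightarrow> vech A (lower_tri_index (i, j)) = A $ i $ j"
  by (simp add: vech_def lower_tri_index)

lemma sym_of_vec_vech:
  assumes "A \<in> Sym"
  shows "sym_of_vec (vech A) = A"
proof -
  have "A $ j $ i = A $ i $ j" for i j using assms by (auto simp: Sym_def transpose_def vec_eq_iff)
  then show ?thesis
    by (simp add: sym_of_vec_def vec_eq_iff max_def min_def vech_lower_tri_index)
qed

lemma vech_in_esp: "vech (A :: ('n::{finite,linorder}) mtx) \<in> esp (CARD('n) * (CARD('n) + 1) div 2)"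
  by (auto simp: vech_def esp_def length_lower_tri)

lemma vech_sym_of_vec:
  assumes "x \<in> esp (CARD('n) * (CARD('n) + 1) div 2)"
  shows "vech (sym_of_vec x :: ('n::{finite,linorder}) mtx) = x"
proof
  fix l
  show "vech (sym_of_vec x :: 'n mtx) l = x l"
  proof (cases "l < length (lower_tri :: ('n \<times> 'n) list)")
    case True
    obtain i j where ij: "lower_tri ! l = (i, j :: 'n)" by fastforce
    have "(i, j) \<in> set lower_tri" using nth_mem[OF True] ij by simp
    then have "j \<le> i" by (simp add: set_lower_tri)
    then show ?thesis
      using True ij lower_tri_index_nth[OF True] by (simp add: vech_def sym_of_vec_def)
  next
    case False
    with assms show ?thesis by (simp add: vech_def esp_def length_lower_tri)
  qed
qed

lemma inj_on_vech: "inj_on vech Sym"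
  by (metis inj_on_inverseI sym_of_vec_vech)

lemma unvech_eq:
  assumes "x \<in> esp (CARD('n) * (CARD('n) + 1) div 2)"
  shows "(unvech x :: ('n::{finite,linorder}) mtx) = sym_of_vec x"
proof -
  have "inv_into Sym vech (vech (sym_of_vec x :: 'n mtx)) = (sym_of_vec x :: 'n mtx)"
    by (rule inv_into_f_f[OF inj_on_vech sym_of_vec_in_Sym])
  then show ?thesis by (simp add: unvech_def vech_sym_of_vec[OF assms])
qed

lemma unvech_vech: "A \<in> Sym \<Longrightarrow> unvech (vech A) = A"
  by (subst unvech_eq[OF vech_in_esp]) (rule sym_of_vec_vech)

lemma unvech_in_Sym:
  "x \<in> esp (CARD('n) * (CARD('n) + 1) div 2) \<Longrightarrow> (unvech x :: ('n::{finite,linorder}) mtx) \<in> Sym"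
  by (simp add: unvech_eq sym_of_vec_in_Sym)

lemma vech_unvech:
  "x \<in> esp (CARD('n) * (CARD('n) + 1) div 2) \<Longrightarrow> vech (unvech x :: ('n::{finite,linorder}) mtx) = x"
  by (simp add: unvech_eq vech_sym_of_vec)

lemma continuous_on_if_const:
  assumes "b \<Longrightarrow> continuous_on S f" "\<not> b \<Longrightarrow> continuous_on S g"
  shows "continuous_on S (\<lambda>x. if b then f x else g x)"
  using assms by (cases b) auto

lemma continuous_on_vech_component: "continuous_on S (\<lambda>A. vech A l)"
  unfolding vech_def case_prod_beta by (intro continuous_on_if_const continuous_intros)

lemma continuous_on_vech: "continuous_on S vech"
  by (intro continuous_on_coordinatewise_then_product continuous_on_vech_component)

lemma continuous_on_unvech:
  "continuous_on (esp (CARD('n) * (CARD('n) + 1) div 2))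
     (unvech :: _ \<Rightarrow> ('n::{finite,linorder}) mtx)"
proof -
  have "continuous_on (esp (CARD('n) * (CARD('n) + 1) div 2)) (sym_of_vec :: _ \<Rightarrow> 'n mtx)"
    unfolding sym_of_vec_def
    by (intro continuous_on_vec_lambda continuous_on_subset[OF continuous_on_product_coordinates]) auto
  then show ?thesis by (simp add: unvech_eq cong: continuous_on_cong)
qed

section \<open>Transport of open sets, closures and the degree\<close>

lemma openin_vech_image:
  fixes U :: "(('n::{finite,linorder}) mtx) set"
  assumes "openin (top_of_set Sym) U"
  shows "openin (top_of_set (esp (CARD('n) * (CARD('n) + 1) div 2))) (vech ` U)"
proof -
  let ?E = "esp (CARD('n) * (CARD('n) + 1) div 2)"
  have US: "U \<subseteq> Sym" using assms openin_imp_subset by blast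
  have "vech ` U = ?E \<inter> unvech -` U"
  proof (intro equalityI subsetI)
    fix x assume "x \<in> vech ` U"
    then obtain A where "A \<in> U" "x = vech A" by blast
    then show "x \<in> ?E \<inter> unvech -` U" using US vech_in_esp[of A] unvech_vech[of A] by auto
  next
    fix x assume x: "x \<in> ?E \<inter> unvech -` U"
    then have "x = vech (unvech x :: 'n mtx)" using vech_unvech[where 'n = 'n, of x] by auto
    with x show "x \<in> vech ` U" by blast
  qed
  moreover have "openin (top_of_set ?E) (?E \<inter> unvech -` U)"
    by (rule continuous_openin_preimage[OF continuous_on_unvech _ assms]) (auto simp: unvech_in_Sym)
  ultimately show ?thesis by simp
qed

lemma unvech_closure:
  fixes U :: "(('n::{finite,linorder}) mtx) set"
  assumes "U \<subseteq> Sym" "x \<in> closure (vech ` U)"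
  shows "x \<in> esp (CARD('n) * (CARD('n) + 1) div 2)" and "unvech x \<in> closure U"
proof -
  let ?E = "esp (CARD('n) * (CARD('n) + 1) div 2)"
  have "closed (?E \<inter> unvech -` closure U)"
    by (intro continuous_closed_preimage continuous_on_unvech closed_esp closed_closure)
  moreover have "vech ` U \<subseteq> ?E \<inter> unvech -` closure U"
  proof
    fix x assume "x \<in> vech ` U"
    then obtain A where A: "A \<in> U" "x = vech A" by blast
    then have "A \<in> closure U" using closure_subset by blast
    then show "x \<in> ?E \<inter> unvech -` closure U"
      using A assms(1) vech_in_esp[of A] unvech_vech[of A] by auto
  qed
  ultimately have "closure (vech ` U) \<subseteq> ?E \<inter> unvech -` closure U" by (rule closure_minimal[rotated])
  with assms(2) show "x \<in> ?E" "unvech x \<in> closure U" by auto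
qed

lemma closure_diff_vech_image_nonempty:
  assumes "U \<subseteq> Sym" "closure U - U \<noteq> {}"
  shows "closure (vech ` U) - vech ` U \<noteq> {}"
proof -
  obtain X where X: "X \<in> closure U" "X \<notin> U" using assms by blast
  have "vech X \<in> closure (vech ` U)"
    using image_closure_subset[OF continuous_on_vech closed_closure closure_subset] X(1) by blast
  moreover have "X \<in> Sym" using X(1) assms(1) closed_Sym closure_minimal by blast
  then have "vech X \<notin> vech ` U" using X(2) assms(1) inj_on_vech by (auto dest: inj_onD)
  ultimately show ?thesis by blast
qed

lemma vech_image_bounded:
  fixes U :: "(('n::{finite,linorder}) mtx) set"
  assumes "bounded U"
  obtains R where "\<And>x. x \<in> vech ` U \<Longrightarrow> enorm N x \<le> R"
proof -
  have "compact (closure U)" using assms by simp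
  moreover have "continuous_on (closure U) (\<lambda>A. enorm N (vech A))"
    by (intro continuous_on_enorm continuous_on_vech_component)
  ultimately have "bounded ((\<lambda>A. enorm N (vech A)) ` closure U)"
    by (intro compact_imp_bounded compact_continuous_image)
  then obtain R where "\<forall>A\<in>closure U. \<bar>enorm N (vech A)\<bar> \<le> R"
    by (auto simp: bounded_iff)
  then have "enorm N x \<le> R" if "x \<in> vech ` U" for x
    using that closure_subset[of U] by force
  with that show ?thesis by blast
qed

lemma sym_deg_homotopy:
  fixes h :: "real \<Rightarrow> ('n::{finite,linorder}) mtx \<Rightarrow> ('n::{finite,linorder}) mtx"
  assumes U: "openin (top_of_set Sym) U" "bounded U" "closure U - U \<noteq> {}"
    and cont: "continuous_on ({0..1} \<times> closure U) (\<lambda>z. h (fst z) (snd z))"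
    and h: "\<And>t X. t \<in> {0..1} \<Longrightarrow> X \<in> closure U \<Longrightarrow> h t X \<in> Sym"
    and P: "P \<in> Sym" "\<And>t X. t \<in> {0..1} \<Longrightarrow> X \<in> closure U - U \<Longrightarrow> h t X \<noteq> P"
  shows "sym_deg (h 0) U P = sym_deg (h 1) U P"
proof -
  let ?N = "CARD('n) * (CARD('n) + 1) div 2"
  have US: "U \<subseteq> Sym" using U(1) openin_imp_subset by blast
  obtain R where R: "\<And>x. x \<in> vech ` U \<Longrightarrow> enorm ?N x \<le> R" using vech_image_bounded[OF U(2), of ?N] by blast
  show ?thesis unfolding sym_deg_def
  proof (rule brouwer_deg_homotopy[OF openin_vech_image[OF U(1)]
        closure_diff_vech_image_nonempty[OF US U(3)] R, where h = "\<lambda>t. vech \<circ> h t \<circ> unvech"])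
    have 1: "continuous_on ({0..1::real} \<times> closure (vech ` U)) (\<lambda>z. (fst z, unvech (snd z) :: 'n mtx))"
      by (intro continuous_intros continuous_on_compose2[OF continuous_on_unvech])
        (auto dest: unvech_closure(1)[OF US])
    have 2: "(\<lambda>z. (fst z, unvech (snd z))) ` ({0..1::real} \<times> closure (vech ` U)) \<subseteq> {0..1} \<times> closure U"
      by (auto dest: unvech_closure(2)[OF US])
    have 3: "continuous_on ({0..1::real} \<times> closure (vech ` U)) (\<lambda>z. h (fst z) (unvech (snd z)))"
      using continuous_on_compose2[OF cont 1 2] by simp
    show "continuous_on ({0..1} \<times> closure (vech ` U)) (\<lambda>z. (vech \<circ> h (fst z) \<circ> unvech) (snd z) i)" for i
      using continuous_on_compose2[OF continuous_on_vech_component[of UNIV i] 3] by simp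
    fix t :: real and x :: "nat \<Rightarrow> real"
    assume t: "t \<in> {0..1}" and x: "x \<in> closure (vech ` U) - vech ` U"
    have xE: "x \<in> esp ?N" and xU: "(unvech x :: 'n mtx) \<in> closure U"
      using unvech_closure[OF US] x by auto
    have "(unvech x :: 'n mtx) \<notin> U" using x vech_unvech[OF xE] by (metis DiffD2 imageI)
    with P t xU have "h t (unvech x) \<noteq> P" by blast
    then have "vech (h t (unvech x)) \<noteq> vech P" using h[OF t xU] P(1) inj_on_vech by (auto dest: inj_onD)
    then obtain i where i: "vech (h t (unvech x)) i \<noteq> vech P i" by auto
    \<comment> \<open>Both vectors are 0 from position \<open>?N\<close> on, so a differing
      coordinate must come earlier.\<close>
    then have "i < ?N" by (metis vech_def length_lower_tri)
    with i show "\<exists>i<?N. (vech \<circ> h t \<circ> unvech) x i \<noteq> vech P i" by auto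
  qed
qed

text \<open>\<open>vech \<circ> unvech\<close> is the identity only on \<open>esp N\<close>. The
  degree sees no other points: the frontier lies in \<open>esp N\<close>, and so does every value of
  \<open>stereo\<close>.\<close>

lemma brouwer_deg_cong:
  assumes "\<And>x. x \<in> esp N \<Longrightarrow> g x = g' x" "openin (top_of_set (esp N)) V"
  shows "brouwer_deg N g V y = brouwer_deg N g' V y"
proof -
  have "closure V \<subseteq> esp N"
    using assms(2) closed_esp by (intro closure_minimal openin_imp_subset)
  then have "boundary_dist N g V y = boundary_dist N g' V y"
    unfolding boundary_dist_def frontier_of_Euclidean_space[OF assms(2)]
    by (intro arg_cong[where f = Inf] image_cong) (use assms(1) in auto)
  then have "sphere_map N g V y = sphere_map N g' V y"
    using assms(1)[OF stereo_in_esp] by (simp add: sphere_map_def fun_eq_iff)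
  then show ?thesis by (simp add: brouwer_deg_def)
qed

lemma sym_deg_id:
  fixes P :: "('n::{finite,linorder}) mtx"
  assumes U: "openin (top_of_set Sym) U" "bounded U" "closure U - U \<noteq> {}" and P: "P \<in> U"
  shows "sym_deg (\<lambda>X. X) U P = 1"
proof -
  let ?N = "CARD('n) * (CARD('n) + 1) div 2"
  have US: "U \<subseteq> Sym" using U(1) openin_imp_subset by blast
  obtain R where R: "\<And>x. x \<in> vech ` U \<Longrightarrow> enorm ?N x \<le> R" using vech_image_bounded[OF U(2), of ?N] by blast
  have "sym_deg (\<lambda>X. X) U P = brouwer_deg ?N (\<lambda>x. x) (vech ` U) (vech P)"
    unfolding sym_deg_def
    by (rule brouwer_deg_cong[OF _ openin_vech_image[OF U(1)]]) (simp add: vech_unvech)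
  also have "\<dots> = 1"
    by (rule brouwer_deg_id[OF openin_vech_image[OF U(1)] closure_diff_vech_image_nonempty[OF US U(3)] R])
      (use P in auto)
  finally show ?thesis .
qed

section \<open>Definite matrices\<close>

lemma Sym_inner:
  fixes A :: "real^'n^'n"
  assumes "A \<in> Sym"
  shows "x \<bullet> (A *v y) = (A *v x) \<bullet> y"
  using assms dot_lmul_matrix[of x A y] transpose_matrix_vector[of A x] by (simp add: Sym_def)

lemma mat_1_in_Sym: "mat 1 \<in> Sym"
  by (simp add: Sym_def transpose_mat)

text \<open>Otherwise the form would become negative along \<open>v - t A v\<close>: at
  \<open>t = 0\<close> it is 0 with derivative -2 |A v|^2.\<close>

lemma psd_form_kernel:
  fixes A :: "real^'n^'n"
  assumes A: "A \<in> Sym" "\<And>x. 0 \<le> x \<bullet> (A *v x)" and v: "v \<bullet> (A *v v) = 0"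
  shows "A *v v = 0"
proof (rule ccontr)
  define w where "w = A *v v"
  define a where "a = w \<bullet> w"
  define b where "b = w \<bullet> (A *v w)"
  assume "A *v v \<noteq> 0"
  then have "a > 0" by (simp add: a_def w_def)
  have "b \<ge> 0" using A(2) by (simp add: b_def)
  \<comment> \<open>With this step \<open>t * b\<close> is below \<open>a\<close>, so the quadratic
    term cannot compensate the linear one; the 1 keeps the denominator positive when
    \<open>b = 0\<close>.\<close>
  define t where "t = a / (b + 1)"
  have "0 \<le> (v - t *\<^sub>R w) \<bullet> (A *v (v - t *\<^sub>R w))" by (rule A(2))
  also have "\<dots> = - (2 * t * a) + t\<^sup>2 * b"
    using v Sym_inner[OF A(1), of v w]
    by (simp add: matrix_vector_mult_diff_distrib matrix_vector_mult_scaleR inner_diff_left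
        inner_diff_right a_def b_def w_def power2_eq_square right_diff_distrib)
  also have "\<dots> = t * (t * b - 2 * a)" by (simp add: algebra_simps power2_eq_square)
  finally have "0 \<le> t * (t * b - 2 * a)" .
  moreover have "t > 0" using \<open>a > 0\<close> \<open>b \<ge> 0\<close> by (simp add: t_def)
  moreover have "t * b < 2 * a"
    using \<open>a > 0\<close> \<open>b \<ge> 0\<close> by (simp add: t_def field_simps add_nonneg_pos)
  ultimately show False by (simp add: zero_le_mult_iff)
qed

text \<open>The minimum of the Rayleigh quotient is an eigenvalue.\<close>

lemma Sym_smallest_eigenvalue:
  fixes A :: "real^'n^'n"
  assumes A: "A \<in> Sym"
  obtains c where "is_eigenvalue A c" "\<And>x. c * (x \<bullet> x) \<le> x \<bullet> (A *v x)"
proof -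
  have "continuous_on (sphere (0::real^'n) 1) (\<lambda>x. x \<bullet> (A *v x))"
    by (intro continuous_intros linear_continuous_on matrix_vector_mul_bounded_linear)
  moreover have "sphere (0::real^'n) 1 \<noteq> {}" by simp
  ultimately obtain v where v: "v \<in> sphere 0 1"
    and min: "\<And>x. x \<in> sphere 0 1 \<Longrightarrow> v \<bullet> (A *v v) \<le> x \<bullet> (A *v x)"
    using continuous_attains_inf[of "sphere (0::real^'n) 1"] compact_sphere by blast
  define c where "c = v \<bullet> (A *v v)"
  have vv: "v \<bullet> v = 1" using v by (simp add: dot_square_norm)
  have le: "c * (x \<bullet> x) \<le> x \<bullet> (A *v x)" for x
  proof (cases "x = 0")
    case False
    have "c \<le> (inverse (norm x) *\<^sub>R x) \<bullet> (A *v (inverse (norm x) *\<^sub>R x))"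
      unfolding c_def by (rule min) (use False in simp)
    also have "\<dots> = (x \<bullet> (A *v x)) / (norm x)\<^sup>2"
      by (simp add: matrix_vector_mult_scaleR power2_eq_square divide_inverse)
    finally show ?thesis using False by (simp add: dot_square_norm field_simps)
  qed simp
  \<comment> \<open>Subtracting the minimal Rayleigh quotient leaves a nonnegative form that
    vanishes at the minimizer, so \<open>psd_form_kernel\<close> makes \<open>v\<close> an
    eigenvector.\<close>
  define M where "M = A - c *\<^sub>R mat 1"
  have "M \<in> Sym" unfolding M_def
    by (intro subspace_diff subspace_scale subspace_Sym A mat_1_in_Sym)
  have M: "M *v x = A *v x - c *\<^sub>R x" for x
    by (simp add: M_def matrix_vector_mult_diff_rdistrib flip: scaleR_matrix_vector_assoc)
  have "M *v v = 0"
    using \<open>M \<in> Sym\<close> le by (intro psd_form_kernel) (auto simp: M inner_diff_right c_def vv)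
  then have "is_eigenvalue A c" using vv by (auto simp: is_eigenvalue_def M intro!: exI[of _ v])
  with le that show ?thesis by blast
qed

lemma pos_semidef_iff:
  "pos_semidef A \<longleftrightarrow> A \<in> Sym \<and> (\<forall>x. 0 \<le> x \<bullet> (A *v x))"
proof
  assume A: "pos_semidef A"
  then obtain c where "c \<ge> 0" "\<And>x. c * (x \<bullet> x) \<le> x \<bullet> (A *v x)"
    using Sym_smallest_eigenvalue by (metis pos_semidef_def)
  then have "0 \<le> x \<bullet> (A *v x)" for x by (meson inner_ge_zero mult_nonneg_nonneg order_trans)
  with A show "A \<in> Sym \<and> (\<forall>x. 0 \<le> x \<bullet> (A *v x))" by (simp add: pos_semidef_def)
next
  assume A: "A \<in> Sym \<and> (\<forall>x. 0 \<le> x \<bullet> (A *v x))"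
  have "c \<ge> 0" if v: "v \<noteq> 0" "A *v v = c *\<^sub>R v" for c v
  proof -
    have "0 \<le> c * (v \<bullet> v)" using A v(2) by (metis inner_scaleR_right)
    moreover have "v \<bullet> v > 0" using v(1) by simp
    ultimately show ?thesis by (simp add: zero_le_mult_iff)
  qed
  with A show "pos_semidef A" by (auto simp: pos_semidef_def is_eigenvalue_def)
qed

lemma pos_def_iff:
  "pos_def A \<longleftrightarrow> A \<in> Sym \<and> (\<forall>x. x \<noteq> 0 \<longrightarrow> 0 < x \<bullet> (A *v x))"
proof
  assume A: "pos_def A"
  then obtain c where c: "c > 0" "\<And>x. c * (x \<bullet> x) \<le> x \<bullet> (A *v x)"
    using Sym_smallest_eigenvalue by (metis pos_def_def)
  have "0 < x \<bullet> (A *v x)" if "x \<noteq> 0" for x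
    using c(1) c(2)[of x] that by (smt (verit) inner_gt_zero_iff mult_pos_pos)
  with A show "A \<in> Sym \<and> (\<forall>x. x \<noteq> 0 \<longrightarrow> 0 < x \<bullet> (A *v x))" by (simp add: pos_def_def)
next
  assume A: "A \<in> Sym \<and> (\<forall>x. x \<noteq> 0 \<longrightarrow> 0 < x \<bullet> (A *v x))"
  have "c > 0" if v: "v \<noteq> 0" "A *v v = c *\<^sub>R v" for c v
  proof -
    have "0 < c * (v \<bullet> v)" using A v by (metis inner_scaleR_right)
    moreover have "v \<bullet> v > 0" using v(1) by simp
    ultimately show ?thesis by (simp add: zero_less_mult_iff)
  qed
  with A show "pos_def A" by (auto simp: pos_def_def is_eigenvalue_def)
qed

lemma pos_def_imp_pos_semidef: "pos_def A \<Longrightarrow> pos_semidef A"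
  by (force simp: pos_def_def pos_semidef_def)

lemma pos_semidef_singular:
  assumes "pos_semidef A" "\<not> pos_def A"
  obtains v where "v \<noteq> 0" "A *v v = 0"
proof -
  obtain c where "is_eigenvalue A c" "\<not> c > 0" using assms by (auto simp: pos_def_def pos_semidef_def)
  moreover from this have "c = 0" using assms(1) by (force simp: pos_semidef_def)
  ultimately show ?thesis using that by (auto simp: is_eigenvalue_def)
qed

lemma invertible_kernel: "invertible A \<Longrightarrow> A *v v = 0 \<Longrightarrow> v = 0" for A :: "real^'n^'n"
  using inj_matrix_vector_mult[of A] by (metis injD matrix_vector_mult_0_right)

lemma pos_semidef_invertible_iff: "pos_semidef A \<and> invertible A \<longleftrightarrow> pos_def A"
proof
  show "pos_semidef A \<and> invertible A \<Longrightarrow> pos_def A"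
    by (metis pos_semidef_singular invertible_kernel)
next
  assume A: "pos_def A"
  then have "A *v x \<noteq> 0" if "x \<noteq> 0" for x using that by (force simp: pos_def_iff)
  then have "invertible A" unfolding invertible_left_inverse matrix_left_invertible_ker by blast
  with A show "pos_semidef A \<and> invertible A" by (simp add: pos_def_imp_pos_semidef)
qed

lemma pos_def_mat_1: "pos_def (mat 1)"
  by (simp add: pos_def_iff mat_1_in_Sym)

lemma pos_def_convex:
  assumes A: "pos_def A" "pos_def B" and t: "t \<in> {0..1}"
  shows "pos_def ((1 - t) *\<^sub>R A + t *\<^sub>R B)"
proof -
  have "0 < x \<bullet> (((1 - t) *\<^sub>R A + t *\<^sub>R B) *v x)" if "x \<noteq> 0" for x
  proof -
    have "0 < x \<bullet> (A *v x)" "0 < x \<bullet> (B *v x)" using A that by (auto simp: pos_def_iff)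
    moreover have "x \<bullet> (((1 - t) *\<^sub>R A + t *\<^sub>R B) *v x) = (1 - t) * (x \<bullet> (A *v x)) + t * (x \<bullet> (B *v x))"
      by (simp add: matrix_vector_mult_add_rdistrib inner_add_right flip: scaleR_matrix_vector_assoc)
    ultimately show ?thesis using t
      by (cases "t = 0") (auto intro!: add_nonneg_pos)
  qed
  with A show ?thesis
    by (auto simp: pos_def_iff intro!: subspace_add subspace_scale subspace_Sym)
qed

lemma pos_semidef_scale: "pos_semidef A \<Longrightarrow> 0 \<le> c \<Longrightarrow> pos_semidef (c *\<^sub>R A)"
  by (auto simp: pos_semidef_iff subspace_scale[OF subspace_Sym] simp flip: scaleR_matrix_vector_assoc)

section \<open>Topology of the cone of definite matrices\<close>

lemma continuous_on_matrix_vector_mult [continuous_intros]: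
  fixes f :: "'a::topological_space \<Rightarrow> real^'n^'m"
  assumes "continuous_on S f" "continuous_on S g"
  shows "continuous_on S (\<lambda>x. f x *v g x)"
  unfolding matrix_vector_mult_def using assms by (intro continuous_intros)

lemma continuous_on_matrix_mult [continuous_intros]:
  fixes f :: "'a::topological_space \<Rightarrow> real^'n^'m"
  assumes "continuous_on S f" "continuous_on S g"
  shows "continuous_on S (\<lambda>x. f x ** g x)"
  unfolding matrix_matrix_mult_def using assms by (intro continuous_intros)

lemma closed_pos_semidef: "closed {A::real^'n^'n. pos_semidef A}"
proof -
  have "{A::real^'n^'n. pos_semidef A} = Sym \<inter> (\<Inter>x. {A. 0 \<le> x \<bullet> (A *v x)})"
    by (auto simp: pos_semidef_iff)
  moreover have "closed (\<Inter>x. {A::real^'n^'n. 0 \<le> x \<bullet> (A *v x)})"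
    by (intro closed_INT ballI closed_Collect_le continuous_intros)
  ultimately show ?thesis using closed_Int[OF closed_Sym] by simp
qed

text \<open>By scaling, definiteness fails for a symmetric matrix exactly when some unit vector
  gives a nonpositive form. The matrices with such a vector form the projection of a closed set
  along the compact sphere, hence a closed set.\<close>

lemma openin_pos_def: "openin (top_of_set Sym) {A::real^'n^'n. pos_def A}"
proof -
  define T where "T = {z :: (real^'n) \<times> (real^'n^'n). fst z \<bullet> (snd z *v fst z) \<le> 0}"
  have "closed T" unfolding T_def by (intro closed_Collect_le continuous_intros)
  then have cl: "closed {A. \<exists>x. x \<in> sphere 0 1 \<and> (x, A) \<in> T}"
    by (rule closed_compact_projection[OF compact_sphere])
  have "pos_def A \<longleftrightarrow> A \<in> Sym \<and> \<not> (\<exists>x. x \<in> sphere 0 1 \<and> (x, A) \<in> T)" for A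
  proof -
    have "0 < x \<bullet> (A *v x)" if "x \<noteq> 0" "\<forall>y\<in>sphere 0 1. \<not> y \<bullet> (A *v y) \<le> 0" for x
    proof -
      have "0 < (inverse (norm x) *\<^sub>R x) \<bullet> (A *v (inverse (norm x) *\<^sub>R x))"
        using bspec[OF that(2), of "inverse (norm x) *\<^sub>R x"] that(1) by (simp add: not_le)
      then show ?thesis using that(1) by (simp add: matrix_vector_mult_scaleR zero_less_mult_iff)
    qed
    moreover have "0 < y \<bullet> (A *v y)" if "y \<in> sphere 0 1" "\<forall>x. x \<noteq> 0 \<longrightarrow> 0 < x \<bullet> (A *v x)" for y
      using that by (metis dist_0_norm norm_zero mem_sphere zero_neq_one)
    ultimately show ?thesis by (auto simp: pos_def_iff T_def not_le)
  qed
  then have "{A. pos_def A} = Sym \<inter> - {A. \<exists>x. x \<in> sphere 0 1 \<and> (x, A) \<in> T}" by blast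
  with cl show ?thesis by (auto simp: openin_open open_Compl)
qed

text \<open>Induction in steps of two: by symmetry, the form of the power \<open>q + 2\<close> at
  \<open>x\<close> is the form of the power \<open>q\<close> at \<open>A *v x\<close>.\<close>

lemma pos_semidef_funpow_form:
  assumes A: "pos_semidef A"
  shows "0 \<le> x \<bullet> (((*v) A ^^ q) x)"
proof (induction q arbitrary: x rule: nat_induct2)
  case (step q)
  have "((*v) A ^^ (q + 2)) x = A *v (((*v) A ^^ q) (A *v x))"
    by (simp add: funpow_swap1)
  with step[of "A *v x"] A show ?case by (simp add: Sym_inner pos_semidef_iff)
qed (use A in \<open>auto simp: pos_semidef_iff\<close>)

lemma pos_def_funpow_form:
  assumes A: "pos_def A" and "x \<noteq> 0"
  shows "0 < x \<bullet> (((*v) A ^^ q) x)"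
  using \<open>x \<noteq> 0\<close>
proof (induction q arbitrary: x rule: nat_induct2)
  case (step q)
  have "((*v) A ^^ (q + 2)) x = A *v (((*v) A ^^ q) (A *v x))"
    by (simp add: funpow_swap1)
  moreover have "A *v x \<noteq> 0" using A step.prems by (force simp: pos_def_iff)
  ultimately show ?case using step.IH[of "A *v x"] A by (simp add: Sym_inner pos_def_iff)
qed (use A in \<open>auto simp: pos_def_iff\<close>)

section \<open>Interlaced words\<close>

lemma word_subst_append: "word_subst (u @ w) X B = word_subst u X B ** word_subst w X B"
  by (induction u) (auto simp: word_subst_def matrix_mul_assoc)

lemma word_subst_Cons: "word_subst (l # w) X B = letter_subst l X B ** word_subst w X B"
  by (simp add: word_subst_def)

lemma word_subst_Nil: "word_subst [] X B = mat 1"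
  by (simp add: word_subst_def)

lemma word_subst_vector: "word_subst w X B *v v = foldr (\<lambda>l. (*v) (letter_subst l X B)) w v"
  by (induction w) (auto simp: word_subst_Nil word_subst_Cons simp flip: matrix_vector_mul_assoc)

lemma word_subst_cong:
  "(\<And>i. LetB i \<in> set w \<Longrightarrow> B i = B' i) \<Longrightarrow> word_subst w X B = word_subst w X B'"
proof (induction w)
  case (Cons l w)
  then show ?case by (cases l) (auto simp: word_subst_Cons)
qed (simp add: word_subst_Nil)

lemma transpose_word_subst:
  assumes "X \<in> Sym" "\<And>i. B i \<in> Sym"
  shows "transpose (word_subst w X B) = word_subst (rev w) X B"
proof (induction w)
  case (Cons l w)
  have "transpose (letter_subst l X B) = letter_subst l X B" using assms by (cases l) (auto simp: Sym_def)
  with Cons show ?case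
    by (simp add: word_subst_Cons word_subst_append word_subst_Nil matrix_transpose_mul)
qed (simp add: word_subst_Nil transpose_mat)

lemma word_subst_scale:
  "word_subst w (c *\<^sub>R X) B = c ^ count_list w LetX *\<^sub>R word_subst w X B" for X :: "real^'n^'n"
proof (induction w)
  case (Cons l w)
  then show ?case
    by (cases l) (auto simp: word_subst_Cons scalar_matrix_assoc matrix_scalar_ac mult_ac)
qed (simp add: word_subst_Nil)

lemma continuous_on_word_subst:
  assumes "continuous_on S X" "\<And>i. continuous_on S (\<lambda>z. B z i)"
  shows "continuous_on S (\<lambda>z. word_subst w (X z) (B z))"
proof (induction w)
  case (Cons l w)
  have "continuous_on S (\<lambda>z. letter_subst l (X z) (B z))" using assms by (cases l) auto
  with Cons show ?case by (simp add: word_subst_Cons continuous_on_matrix_mult)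
qed (simp add: word_subst_Nil)

lemma det_word_subst_eq_0:
  "LetX \<in> set w \<Longrightarrow> det X = 0 \<Longrightarrow> det (word_subst w X B) = 0" for X :: "real^'n^'n"
  by (induction w) (auto simp: word_subst_Cons det_mul)

lemma word_subst_mat_1:
  "word_subst w X (\<lambda>_. mat 1) *v v = ((*v) X ^^ count_list w LetX) v"
proof (induction w)
  case (Cons l w)
  then show ?case by (cases l) (auto simp: word_subst_Cons simp flip: matrix_vector_mul_assoc)
qed (simp add: word_subst_Nil)

lemma interlaced_LetX:
  assumes "interlaced k w"
  shows "LetX \<in> set w"
proof -
  from assms obtain m i p q where m: "m \<ge> 1" "\<forall>j\<in>{1..m}. p j > (0::nat)" and
    weq: "w = replicate (q 1) (LetB (i 1)) @
       concat (map (\<lambda>j. replicate (p j) LetX @ replicate (q (j+1)) (LetB (i (j+1)))) [1..<m+1])"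
    unfolding interlaced_def by blast
  have "\<exists>j\<in>{1..<m+1}. 0 < p j" using m by (intro bexI[of _ 1]) auto
  then show ?thesis by (auto simp: weq in_set_replicate simp del: upt_Suc)
qed

lemma interlaced_letters:
  assumes "interlaced k w" "LetB j \<in> set w"
  shows "j \<in> {1..k}"
proof -
  from assms(1) obtain m i p q where i: "\<forall>j\<in>{1..m+1}. i j \<in> {1..k}" and
    weq: "w = replicate (q 1) (LetB (i 1)) @
       concat (map (\<lambda>j. replicate (p j) LetX @ replicate (q (j+1)) (LetB (i (j+1)))) [1..<m+1])"
    unfolding interlaced_def by blast
  have "j = i 1 \<or> (\<exists>l\<in>{1..<m+1}. j = i (l+1))"
    using assms(2) unfolding weq by (auto simp: in_set_replicate simp del: upt_Suc)
  then show ?thesis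
  proof
    assume "\<exists>l\<in>{1..<m+1}. j = i (l+1)"
    then obtain l where l: "l \<in> {1..<m+1}" "j = i (l+1)" by blast
    then have "l + 1 \<in> {1..m+1}" by auto
    with i l(2) show ?thesis by blast
  qed (use i in auto)
qed

text \<open>For positive definite \<open>C\<close>, the map \<open>Y C\<close> is injective on the range of \<open>Y\<close>: if \<open>z = Y u\<close>
  and \<open>Y C z = 0\<close>, then \<open>z \<bullet> C z = u \<bullet> Y C z = 0\<close>.\<close>

lemma range_step:
  assumes Y: "pos_semidef Y" and C: "pos_def C" and u: "Y *v u \<noteq> 0"
  shows "Y *v (((*v) C ^^ q) (Y *v u)) \<noteq> 0"
proof
  assume "Y *v (((*v) C ^^ q) (Y *v u)) = 0"
  then have "(Y *v u) \<bullet> (((*v) C ^^ q) (Y *v u)) = 0"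
    using Y Sym_inner[of Y u "((*v) C ^^ q) (Y *v u)"] by (simp add: pos_semidef_def)
  with pos_def_funpow_form[OF C u, of q] show False by simp
qed

text \<open>Only the rightmost factor of the power of \<open>Y\<close> acts directly after the power
  of \<open>C\<close>; each further factor is \<open>range_step\<close> with exponent 0.\<close>

lemma range_power_step:
  assumes Y: "pos_semidef Y" and C: "pos_def C" and u: "Y *v u \<noteq> 0" and p: "0 < p"
  shows "\<exists>u'. ((*v) Y ^^ p) (((*v) C ^^ q) (Y *v u)) = Y *v u' \<and> Y *v u' \<noteq> 0"
  using p
proof (induction p rule: nat_induct_non_zero)
  case 1
  show ?case using range_step[OF Y C u] by auto
next
  case (Suc p)
  then obtain u' where "((*v) Y ^^ p) (((*v) C ^^ q) (Y *v u)) = Y *v u'" "Y *v u' \<noteq> 0" by blast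
  then show ?case using range_step[OF Y C, of u' 0] by auto
qed

text \<open>The blocks act from right to left, and each leaves the vector nonzero and in the range
  of \<open>Y\<close>. The leading power of a \<open>B\<close> may take it out of that range, but a
  positive definite matrix cannot take it to 0.\<close>

lemma interlaced_word_nonzero:
  assumes w: "interlaced k w" and Y: "pos_semidef Y" and B: "\<And>i. pos_def (B i)" and u: "Y *v u \<noteq> 0"
  shows "word_subst w Y B *v (Y *v u) \<noteq> 0"
proof -
  from w obtain m i p q where p: "\<forall>j\<in>{1..m}. p j > (0::nat)" and
    weq: "w = replicate (q 1) (LetB (i 1)) @
       concat (map (\<lambda>j. replicate (p j) LetX @ replicate (q (j+1)) (LetB (i (j+1)))) [1..<m+1])"
    unfolding interlaced_def by blast
  define body where "body = concat (map (\<lambda>j. replicate (p j) LetX @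
    replicate (q (j+1)) (LetB (i (j+1)))) [1..<m+1])"
  have wb: "w = replicate (q 1) (LetB (i 1)) @ body" using weq by (simp add: body_def)
  let ?act = "foldr (\<lambda>l. (*v) (letter_subst l Y B))"
  have "\<exists>u'. ?act (concat (map (\<lambda>j. replicate (p j) LetX @ replicate (q (j+1)) (LetB (i (j+1)))) js)) (Y *v u)
      = Y *v u' \<and> Y *v u' \<noteq> 0" if "\<forall>j\<in>set js. p j > 0" for js
    using that
  proof (induction js)
    case Nil
    then show ?case using u by auto
  next
    case (Cons j js)
    then obtain u' where
      "?act (concat (map (\<lambda>j. replicate (p j) LetX @ replicate (q (j+1)) (LetB (i (j+1)))) js)) (Y *v u) = Y *v u'"
      "Y *v u' \<noteq> 0" by auto
    then show ?case
      using range_power_step[OF Y B, of u' "p j" "q (j+1)"] Cons.prems by (simp add: foldr_replicate)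
  qed
  from this[of "[1..<m+1]"] p have "\<exists>u'. ?act body (Y *v u) = Y *v u' \<and> Y *v u' \<noteq> 0"
    by (simp add: body_def del: upt_Suc)
  then obtain u' where
    "word_subst w Y B *v (Y *v u) = ((*v) (B (i 1)) ^^ q 1) (Y *v u')" "Y *v u' \<noteq> 0"
    by (auto simp: word_subst_vector wb foldr_replicate)
  then show ?thesis using pos_def_funpow_form[OF B, of "Y *v u'"] by (metis inner_zero_right less_irrefl)
qed

lemma matrix_nonzero_vector:
  fixes Y :: "real^'n^'n" assumes "Y \<noteq> 0" obtains u where "Y *v u \<noteq> 0"
  using assms by (metis matrix_eq matrix_vector_mult_0)

lemma interlaced_word_subst_nonzero:
  assumes "interlaced k w" "pos_semidef Y" "\<And>i. pos_def (B i)" "Y \<noteq> 0"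
  shows "word_subst w Y B \<noteq> 0"
proof
  assume 0: "word_subst w Y B = 0"
  obtain u where "Y *v u \<noteq> 0" using matrix_nonzero_vector[OF assms(4)] .
  with assms have "word_subst w Y B *v (Y *v u) \<noteq> 0" by (intro interlaced_word_nonzero)
  with 0 show False by simp
qed

text \<open>The constant is the minimum over the unit interval times the compact set of positive
  semidefinite matrices of norm 1. The family \<open>G\<close> is left abstract because both
  homotopies need such a constant.\<close>

lemma pos_semidef_unit_lower_bound:
  fixes G :: "real \<Rightarrow> real^'n^'n \<Rightarrow> real^'n^'n"
  assumes cont: "continuous_on UNIV (\<lambda>z. G (fst z) (snd z))"
    and nz: "\<And>t Y. t \<in> {0..1} \<Longrightarrow> pos_semidef Y \<Longrightarrow> Y \<noteq> 0 \<Longrightarrow> G t Y \<noteq> 0"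
  obtains c where "c > 0" "\<And>t Y. t \<in> {0..1} \<Longrightarrow> pos_semidef Y \<Longrightarrow> norm Y = 1 \<Longrightarrow> c \<le> norm (G t Y)"
proof -
  define K where "K = {0..1::real} \<times> (sphere 0 1 \<inter> {Y::real^'n^'n. pos_semidef Y})"
  have "compact K" unfolding K_def
    by (intro compact_Times compact_Int_closed compact_sphere closed_pos_semidef) auto
  have c: "continuous_on K (\<lambda>z. norm (G (fst z) (snd z)))"
    by (intro continuous_intros continuous_on_subset[OF cont]) auto
  have ne: "K \<noteq> {}"
  proof -
    let ?I = "mat 1 :: real^'n^'n"
    have "?I \<noteq> 0" by (simp add: mat_def vec_eq_iff)
    then have "(0, inverse (norm ?I) *\<^sub>R ?I) \<in> K"
      using pos_semidef_scale[OF pos_def_imp_pos_semidef[OF pos_def_mat_1], of "inverse (norm ?I)"] by (auto simp: K_def)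
    then show ?thesis by blast
  qed
  obtain a where a: "a \<in> K" "\<And>z. z \<in> K \<Longrightarrow> norm (G (fst a) (snd a)) \<le> norm (G (fst z) (snd z))"
    using continuous_attains_inf[OF \<open>compact K\<close> ne c] by blast
  show ?thesis
  proof (rule that[of "norm (G (fst a) (snd a))"])
    show "0 < norm (G (fst a) (snd a))" using a(1) nz[of "fst a" "snd a"] by (force simp: K_def)
    show "norm (G (fst a) (snd a)) \<le> norm (G t Y)" if "t \<in> {0..1}" "pos_semidef Y" "norm Y = 1" for t Y
      using a(2)[of "(t, Y)"] that by (auto simp: K_def)
  qed
qed

section \<open>The homotopy from the word map to the identity\<close>

text \<open>The rescaling step shared by both homotopies. The factor \<open>\<sigma>\<close> is what
  comes out when \<open>X\<close> is normalized; it need not be a pure power of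
  \<open>norm X\<close>, only at least \<open>norm X\<close>.\<close>

lemma norm_le_of_homogeneous:
  fixes X P :: "'n::finite mtx"
  assumes c: "0 < c" "\<And>Y. pos_semidef Y \<Longrightarrow> norm Y = 1 \<Longrightarrow> c \<le> norm (G Y)"
    and hom: "norm P = \<sigma> * norm (G (inverse (norm X) *\<^sub>R X))" and \<sigma>: "norm X \<le> \<sigma>"
    and X: "pos_semidef X" "1 \<le> norm X"
  shows "norm X \<le> norm P / c"
proof -
  have "c \<le> norm (G (inverse (norm X) *\<^sub>R X))"
  proof (intro c(2) pos_semidef_scale X)
    have "norm X \<noteq> 0" using X(2) by linarith
    then show "norm (inverse (norm X) *\<^sub>R X) = 1" by simp
  qed simp
  then have "norm X * c \<le> norm P"
    unfolding hom using \<sigma> c(1) X(2) by (intro mult_mono) auto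
  then show ?thesis using c(1) by (simp add: field_simps)
qed

lemma interlaced_solutions_bounded:
  fixes B :: "nat \<Rightarrow> 'n::finite mtx"
  assumes S: "interlaced k S" and B: "\<And>i. pos_def (B i)"
  shows "\<exists>R. \<forall>t\<in>{0..1}. \<forall>X. pos_semidef X \<longrightarrow>
    word_subst S X (\<lambda>i. (1 - t) *\<^sub>R B i + t *\<^sub>R mat 1) = P \<longrightarrow> norm X < R"
proof -
  define h where "h = (\<lambda>t X. word_subst S X (\<lambda>i. (1 - t) *\<^sub>R B i + t *\<^sub>R mat 1))"
  have "continuous_on UNIV (\<lambda>z. h (fst z) (snd z))"
    unfolding h_def by (intro continuous_on_word_subst continuous_intros)
  moreover have "h t Y \<noteq> 0" if "t \<in> {0..1}" "pos_semidef Y" "Y \<noteq> 0" for t Y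
    unfolding h_def
    by (intro interlaced_word_subst_nonzero[OF S] pos_def_convex B pos_def_mat_1 that)
  ultimately obtain c where c: "c > 0"
    "\<And>t Y. t \<in> {0..1} \<Longrightarrow> pos_semidef Y \<Longrightarrow> norm Y = 1 \<Longrightarrow> c \<le> norm (h t Y)"
    using pos_semidef_unit_lower_bound[of h] by blast
  \<comment> \<open>The summand 1 covers \<open>norm X < 1\<close>; rescaling is used only from norm
    1 on, where a positive power of the norm is at least the norm.\<close>
  have "norm X < 1 + norm P / c" if t: "t \<in> {0..1}" and X: "pos_semidef X" and eq: "h t X = P" for t X
  proof (cases "1 \<le> norm X")
    case True
    let ?d = "count_list S LetX"
    have "?d \<noteq> 0" using interlaced_LetX[OF S] by (simp add: count_list_0_iff)
    have "norm X \<noteq> 0" using True by linarith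
    then have "h t X = h t (norm X *\<^sub>R (inverse (norm X) *\<^sub>R X))" by simp
    also have "\<dots> = norm X ^ ?d *\<^sub>R h t (inverse (norm X) *\<^sub>R X)"
      unfolding h_def by (rule word_subst_scale)
    finally have "norm P = norm X ^ ?d * norm (h t (inverse (norm X) *\<^sub>R X))"
      using eq by simp
    moreover have "norm X \<le> norm X ^ ?d" using True \<open>?d \<noteq> 0\<close> by (simp add: self_le_power)
    ultimately have "norm X \<le> norm P / c"
      using norm_le_of_homogeneous[of c "h t"] c t X True by blast
    then show ?thesis by simp
  next
    case False
    with c(1) show ?thesis by (simp add: add_strict_increasing2 not_le less_le_trans)
  qed
  then show ?thesis unfolding h_def by (intro exI[of _ "1 + norm P / c"]) auto
qed

definition power_homotopy :: "word \<Rightarrow> real \<Rightarrow> real^'n^'n \<Rightarrow> real^'n^'n" where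
  "power_homotopy w s X = (1 - s) *\<^sub>R word_subst w X (\<lambda>_. mat 1) + s *\<^sub>R X"

text \<open>Powers of \<open>Y\<close> have nonnegative forms, so nothing can cancel: for
  \<open>s\<close> positive, a zero sum makes the form of \<open>Y\<close> vanish at every
  vector.\<close>

lemma power_homotopy_nonzero:
  assumes w: "interlaced k w" and s: "s \<in> {0..1}" and Y: "pos_semidef Y" "Y \<noteq> 0"
  shows "power_homotopy w s Y \<noteq> 0"
proof
  assume 0: "power_homotopy w s Y = 0"
  let ?W = "word_subst w Y (\<lambda>_. mat 1)"
  show False
  proof (cases "s = 0")
    case True
    with 0 interlaced_word_subst_nonzero[OF w Y(1) pos_def_mat_1 Y(2)] show ?thesis
      by (simp add: power_homotopy_def)
  next
    case False
    have "Y *v x = 0" for x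
    proof (rule psd_form_kernel)
      have "0 = x \<bullet> (power_homotopy w s Y *v x)" using 0 by simp
      also have "\<dots> = (1 - s) * (x \<bullet> (?W *v x)) + s * (x \<bullet> (Y *v x))"
        by (simp add: power_homotopy_def matrix_vector_mult_add_rdistrib inner_add_right
            flip: scaleR_matrix_vector_assoc)
      finally have "(1 - s) * (x \<bullet> (?W *v x)) + s * (x \<bullet> (Y *v x)) = 0" by simp
      moreover have "0 \<le> (1 - s) * (x \<bullet> (?W *v x))"
        using s pos_semidef_funpow_form[OF Y(1)] by (simp add: word_subst_mat_1)
      moreover have "0 \<le> s * (x \<bullet> (Y *v x))" using s Y by (simp add: pos_semidef_iff)
      ultimately have "s * (x \<bullet> (Y *v x)) = 0" by linarith
      with False show "x \<bullet> (Y *v x) = 0" by simp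
    qed (use Y in \<open>auto simp: pos_semidef_iff\<close>)
    with Y(2) show ?thesis using matrix_nonzero_vector by blast
  qed
qed

text \<open>Writing \<open>X\<close> as n times a unit matrix \<open>Y\<close> turns the value at
  \<open>s\<close> into \<open>\<sigma>\<close> times the value of the same homotopy at
  \<open>Y\<close> for another parameter \<open>a\<close>. Here \<open>\<sigma>\<close> is the sum
  of the two weights (1-s) n^d and s n, and \<open>a\<close> is the share of the second; the bound
  \<open>c\<close> holds for all parameters, hence also for \<open>a\<close>.\<close>

lemma power_homotopy_solutions_bounded:
  fixes P :: "'n::finite mtx"
  assumes w: "interlaced k w"
  shows "\<exists>R. \<forall>s\<in>{0..1}. \<forall>X. pos_semidef X \<longrightarrow> power_homotopy w s X = P \<longrightarrow> norm X < R"
proof -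
  have "continuous_on UNIV (\<lambda>z. power_homotopy w (fst z) (snd z :: 'n mtx))"
    unfolding power_homotopy_def by (intro continuous_on_word_subst continuous_intros)
  then obtain c where c: "c > 0"
    "\<And>s (Y :: 'n mtx). s \<in> {0..1} \<Longrightarrow> pos_semidef Y \<Longrightarrow> norm Y = 1 \<Longrightarrow> c \<le> norm (power_homotopy w s Y)"
    using pos_semidef_unit_lower_bound[of "power_homotopy w"] power_homotopy_nonzero[OF w] by blast
  have "norm X < 1 + norm P / c"
    if s: "s \<in> {0..1}" and X: "pos_semidef X" and eq: "power_homotopy w s X = P" for s X
  proof (cases "1 \<le> norm X")
    case True
    let ?n = "norm X"
    define Y where "Y = inverse ?n *\<^sub>R X"
    have "?n \<noteq> 0" using True by linarith
    then have XY: "X = ?n *\<^sub>R Y" by (simp add: Y_def)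
    let ?d = "count_list w LetX"
    have "?d \<noteq> 0" using interlaced_LetX[OF w] by (simp add: count_list_0_iff)
    then have le: "?n \<le> ?n ^ ?d" using True by (simp add: self_le_power)
    define \<sigma> where "\<sigma> = (1 - s) * ?n ^ ?d + s * ?n"
    have "(1 - s) * ?n \<le> (1 - s) * ?n ^ ?d" using s le by (intro mult_left_mono) auto
    then have \<sigma>: "?n \<le> \<sigma>" by (simp add: \<sigma>_def algebra_simps)
    then have "\<sigma> > 0" using True by linarith
    define a where "a = s * ?n / \<sigma>"
    have a: "\<sigma> * (1 - a) = (1 - s) * ?n ^ ?d" "\<sigma> * a = s * ?n"
      using \<open>\<sigma> > 0\<close> by (auto simp: a_def right_diff_distrib) (simp add: \<sigma>_def)
    have "a \<in> {0..1}"
    proof -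
      have "0 \<le> (1 - s) * ?n ^ ?d" "0 \<le> s * ?n" using s by auto
      then have "s * ?n \<le> \<sigma>" by (simp add: \<sigma>_def)
      with \<open>0 \<le> s * ?n\<close> \<open>\<sigma> > 0\<close> show ?thesis by (simp add: a_def)
    qed
    have "P = (1 - s) *\<^sub>R word_subst w (?n *\<^sub>R Y) (\<lambda>_. mat 1) + s *\<^sub>R (?n *\<^sub>R Y)"
      using eq XY by (simp add: power_homotopy_def)
    also have "\<dots> = \<sigma> *\<^sub>R power_homotopy w a Y"
      by (simp add: word_subst_scale power_homotopy_def scaleR_add_right a)
    finally have "norm P = \<sigma> * norm (power_homotopy w a (inverse (norm X) *\<^sub>R X))"
      using \<open>\<sigma> > 0\<close> by (simp add: Y_def)
    then have "norm X \<le> norm P / c"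
      using norm_le_of_homogeneous[of c "power_homotopy w a"] c \<open>a \<in> {0..1}\<close> \<sigma> X True by blast
    then show ?thesis by simp
  next
    case False
    with c(1) show ?thesis by (simp add: add_strict_increasing2 not_le less_le_trans)
  qed
  then show ?thesis by (intro exI[of _ "1 + norm P / c"]) auto
qed

text \<open>A kernel vector of \<open>X\<close> is killed by both summands. This uses that the word
  has been reduced to a power of \<open>X\<close> with positive exponent.\<close>

lemma power_homotopy_invertible:
  assumes w: "interlaced k w" and X: "pos_semidef X" and inv: "invertible (power_homotopy w s X)"
  shows "pos_def X"
proof (rule ccontr)
  assume "\<not> pos_def X"
  then obtain v where v: "v \<noteq> 0" "X *v v = 0" using X pos_semidef_singular by blast
  obtain d where "count_list w LetX = Suc d"
    using interlaced_LetX[OF w] by (metis count_list_0_iff not0_implies_Suc)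
  moreover have "((*v) X ^^ d) 0 = 0" for d by (induction d) auto
  ultimately have "word_subst w X (\<lambda>_. mat 1) *v v = 0"
    using v by (simp add: word_subst_mat_1 funpow_swap1)
  then have "power_homotopy w s X *v v = 0"
    using v by (simp add: power_homotopy_def matrix_vector_mult_add_rdistrib
        flip: scaleR_matrix_vector_assoc)
  with invertible_kernel[OF inv] v(1) show False by blast
qed

text \<open>The determinant of the word is a product of determinants with \<open>det X\<close> among
  the factors.\<close>

lemma interlaced_invertible:
  assumes "interlaced k w" "pos_semidef X" "invertible (word_subst w X B)"
  shows "pos_def X"
proof -
  have "det X \<noteq> 0"
    using det_word_subst_eq_0[OF interlaced_LetX[OF assms(1)]] assms(3) by (auto simp: invertible_det_nz)
  with assms(2) show ?thesis by (simp add: invertible_det_nz flip: pos_semidef_invertible_iff)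
qed

lemma symmetric_word_subst_in_Sym:
  "symmetric_word w \<Longrightarrow> X \<in> Sym \<Longrightarrow> (\<And>i. B i \<in> Sym) \<Longrightarrow> word_subst w X B \<in> Sym"
  using transpose_word_subst[of X B w] by (simp add: symmetric_word_def Sym_def)

section \<open>The truncated cone of positive definite matrices\<close>

definition pd_ball :: "real \<Rightarrow> (real^'n^'n) set" where
  "pd_ball R = {X. pos_def X \<and> norm X < R}"

lemma openin_pd_ball: "openin (top_of_set Sym) (pd_ball R :: (real^'n^'n) set)"
proof -
  have "pd_ball R = {X. pos_def X} \<inter> (ball 0 R :: (real^'n^'n) set)" by (auto simp: pd_ball_def)
  then show ?thesis using openin_Int_open[OF openin_pos_def open_ball] by metis
qed

lemma bounded_pd_ball: "bounded (pd_ball R)"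
  by (rule bounded_subset[OF bounded_ball[of 0 R]]) (auto simp: pd_ball_def)

lemma closure_pd_ball: "X \<in> closure (pd_ball R) \<Longrightarrow> pos_semidef X"
proof -
  have "pd_ball R \<subseteq> {X. pos_semidef X}" by (auto simp: pd_ball_def pos_def_imp_pos_semidef)
  then have "closure (pd_ball R) \<subseteq> {X. pos_semidef X}" using closed_pos_semidef by (rule closure_minimal)
  then show "X \<in> closure (pd_ball R) \<Longrightarrow> pos_semidef X" by blast
qed

text \<open>Supplies the nonempty frontier on which the boundary distance in the degree relies;
  small multiples of the identity approach 0.\<close>

lemma zero_in_frontier_pd_ball:
  assumes "R > 0"
  shows "(0 :: real^'n^'n) \<in> closure (pd_ball R) - pd_ball R"
proof
  let ?I = "mat 1 :: real^'n^'n"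
  have I: "norm ?I > 0" by (simp add: mat_def vec_eq_iff)
  show "0 \<in> closure (pd_ball R :: (real^'n^'n) set)"
    unfolding closure_approachable
  proof (intro allI impI)
    fix e :: real assume "e > 0"
    define c where "c = min e R / 2 / norm ?I"
    have c: "c > 0" "c * norm ?I < e" "c * norm ?I < R" using \<open>e > 0\<close> assms I by (auto simp: c_def)
    have "c *\<^sub>R ?I \<in> Sym" by (intro subspace_scale subspace_Sym mat_1_in_Sym)
    then have "pos_def (c *\<^sub>R ?I)"
      using c(1) by (simp add: pos_def_iff flip: scaleR_matrix_vector_assoc)
    with c show "\<exists>Y\<in>pd_ball R. dist Y (0 :: real^'n^'n) < e"
      by (intro bexI[of _ "c *\<^sub>R ?I"]) (auto simp: pd_ball_def)
  qed
  have "(axis undefined 1 :: real^'n) \<noteq> 0" by (simp add: axis_eq_0_iff)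
  then show "(0 :: real^'n^'n) \<notin> pd_ball R" by (auto simp: pd_ball_def pos_def_iff)
qed

theorem theorem1p5:
  fixes k :: nat and S :: word
    and B :: "nat \<Rightarrow> real^('n::{finite,linorder})^('n::{finite,linorder})"
    and P :: "real^('n::{finite,linorder})^('n::{finite,linorder})"
  assumes "k \<ge> 1"
    and "interlaced k S"
    and "symmetric_word S"
    and "\<And>i. i \<in> {1..k} \<Longrightarrow> pos_def (B i)"
    and "pos_semidef P"
  shows "bounded {X. pos_semidef X \<and> word_subst S X B = P} \<and>
    (invertible P \<longrightarrow>
      (\<exists>U. bounded U \<and> openin (top_of_set Sym) U \<and> U \<subseteq> {X. pos_def X} \<and>
           {X. pos_semidef X \<and> word_subst S X B = P} \<subseteq> U \<and>
           P \<notin> (\<lambda>X. word_subst S X B) ` (top_of_set Sym frontier_of U) \<and>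
           sym_deg (\<lambda>X. word_subst S X B) U P = 1))"
proof -
  \<comment> \<open>The values of \<open>B\<close> outside the index range are arbitrary, while the
    lemmas on words ask for positive definiteness at every index. The identity fills the gap, and no
    letter of the word refers to it.\<close>
  define B' where "B' i = (if i \<in> {1..k} then B i else mat 1)" for i
  have B': "pos_def (B' i)" for i using assms(4) pos_def_mat_1 by (auto simp: B'_def)
  have subst_eq: "word_subst S X B = word_subst S X B'" for X
    using interlaced_letters[OF assms(2)] by (intro word_subst_cong) (simp add: B'_def)
  define h where "h = (\<lambda>t X. word_subst S X (\<lambda>i. (1 - t) *\<^sub>R B' i + t *\<^sub>R mat 1))"
  have h0: "h 0 = (\<lambda>X. word_subst S X B)" by (simp add: h_def fun_eq_iff subst_eq)
  obtain R1 where R1': "\<forall>t\<in>{0..1}. \<forall>X. pos_semidef X \<longrightarrow> h t X = P \<longrightarrow> norm X < R1"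
    unfolding h_def using interlaced_solutions_bounded[OF assms(2) B', where P = P] ..
  have R1: "norm X < R1" if "t \<in> {0..1}" "pos_semidef X" "h t X = P" for t X
    using R1' that by blast
  have sol: "norm X < R1" if "pos_semidef X" "word_subst S X B = P" for X
    using R1[of 0 X] that by (simp add: h0)
  show ?thesis
  proof (intro conjI impI)
    show "bounded {X. pos_semidef X \<and> word_subst S X B = P}"
      using sol by (auto simp: bounded_iff intro!: exI[of _ R1] less_imp_le)
  next
    assume P: "invertible P"
    let ?p = "power_homotopy S"
    obtain R2 where R2: "\<forall>s\<in>{0..1}. \<forall>X. pos_semidef X \<longrightarrow> ?p s X = P \<longrightarrow> norm X < R2"
      using power_homotopy_solutions_bounded[OF assms(2), where P = P] ..
    \<comment> \<open>The bounds \<open>R1\<close> and \<open>R2\<close> capture the solutions along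
      the two homotopies; \<open>norm P + 1\<close> places \<open>P\<close> itself in
      \<open>U\<close>, as \<open>sym_deg_id\<close> requires.\<close>
    define R where "R = max (max R1 R2) (norm P + 1)"
    have "R > 0" by (simp add: R_def add_nonneg_pos less_max_iff_disj)
    define U where "U = (pd_ball R :: (real^'n::{finite,linorder}^'n::{finite,linorder}) set)"
    have U: "openin (top_of_set Sym) U" "bounded U" "closure U - U \<noteq> {}"
      unfolding U_def using openin_pd_ball bounded_pd_ball zero_in_frontier_pd_ball[OF \<open>R > 0\<close>] by blast+
    have psd: "pos_semidef X" if "X \<in> closure U" for X
      using closure_pd_ball that by (simp add: U_def)
    have Sym: "X \<in> Sym" if "X \<in> closure U" for X
      using psd[OF that] by (simp add: pos_semidef_def)
    have mem: "X \<in> U" if "pos_def X" "norm X < R1 \<or> norm X < R2 \<or> norm X < norm P + 1" for X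
      using that by (auto simp: U_def pd_ball_def R_def)
    have "P \<in> Sym" using assms(5) by (simp add: pos_semidef_def)
    have "P \<in> U" using assms(5) P by (intro mem) (auto simp flip: pos_semidef_invertible_iff)
    \<comment> \<open>Points of the closure of \<open>U\<close> are positive semidefinite, so this
      membership rules out solutions in \<open>closure U - U\<close>.\<close>
    have hU: "X \<in> U" if "t \<in> {0..1}" "pos_semidef X" "h t X = P" for t X
    proof (rule mem)
      show "pos_def X" using interlaced_invertible[OF assms(2) that(2)] that(3) P by (auto simp: h_def)
    qed (use R1 that in blast)
    have pU: "X \<in> U" if "s \<in> {0..1}" "pos_semidef X" "?p s X = P" for s X
    proof (rule mem)
      show "pos_def X" using power_homotopy_invertible[OF assms(2) that(2)] that(3) P by blast
    qed (use R2 that in blast)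
    have "sym_deg (h 0) U P = sym_deg (h 1) U P"
    proof (rule sym_deg_homotopy[OF U])
      show "continuous_on ({0..1} \<times> closure U) (\<lambda>z. h (fst z) (snd z))"
        unfolding h_def by (intro continuous_on_word_subst continuous_intros)
      show "h t X \<in> Sym" if "t \<in> {0..1}" "X \<in> closure U" for t X
        unfolding h_def using pos_def_convex[OF B' pos_def_mat_1 that(1)] Sym that(2)
        by (intro symmetric_word_subst_in_Sym assms(3)) (auto simp: pos_def_def)
      show "h t X \<noteq> P" if "t \<in> {0..1}" "X \<in> closure U - U" for t X
        using hU psd that by blast
    qed fact
    also have "h 1 = ?p 0" by (simp add: h_def power_homotopy_def fun_eq_iff)
    also have "sym_deg (?p 0) U P = sym_deg (?p 1) U P"
    proof (rule sym_deg_homotopy[OF U])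
      show "continuous_on ({0..1} \<times> closure U) (\<lambda>z. ?p (fst z) (snd z))"
        unfolding power_homotopy_def by (intro continuous_on_word_subst continuous_intros)
      show "?p t X \<in> Sym" if "t \<in> {0..1}" "X \<in> closure U" for t X
        unfolding power_homotopy_def using Sym that(2)
        by (intro subspace_add subspace_scale subspace_Sym symmetric_word_subst_in_Sym assms(3) mat_1_in_Sym)
      show "?p t X \<noteq> P" if "t \<in> {0..1}" "X \<in> closure U - U" for t X
        using pU psd that by blast
    qed fact
    also have "?p 1 = (\<lambda>X. X)" by (simp add: power_homotopy_def fun_eq_iff)
    also have "sym_deg (\<lambda>X. X) U P = 1" by (rule sym_deg_id[OF U \<open>P \<in> U\<close>])
    finally have deg: "sym_deg (\<lambda>X. word_subst S X B) U P = 1" by (simp add: h0)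
    have sub: "{X. pos_semidef X \<and> word_subst S X B = P} \<subseteq> U"
      using hU[of 0] by (auto simp: h0)
    have "top_of_set Sym frontier_of U = top_of_set Sym closure_of U - U"
      using U(1) by (simp add: frontier_of_openin)
    also have "\<dots> \<subseteq> closure U - U" by (auto simp: closure_of_subtopology dest: subsetD[OF closure_mono, rotated])
    finally have "P \<notin> (\<lambda>X. word_subst S X B) ` (top_of_set Sym frontier_of U)"
      using sub psd by blast
    with U sub deg show "\<exists>U. bounded U \<and> openin (top_of_set Sym) U \<and> U \<subseteq> {X. pos_def X} \<and>
           {X. pos_semidef X \<and> word_subst S X B = P} \<subseteq> U \<and>
           P \<notin> (\<lambda>X. word_subst S X B) ` (top_of_set Sym frontier_of U) \<and>
           sym_deg (\<lambda>X. word_subst S X B) U P = 1"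
      by (intro exI[of _ U]) (auto simp: U_def pd_ball_def)
  qed
qed

end
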